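(* Let $d\ge 1$ and let $G=(V,E)$ be a fully periodic, connected, locally finite, simple graph in $\mathbb{R}^d$ (with $V\neq\emptyset$). Then there exists a fully periodic solution to the 1-2-3 problem for $G$, i.e. a weight function $w:E\to\{1,2,3\}$ such that $s_w(u)\neq s_w(v)$ for every edge $uv\in E$, together with a subgroup $\Gamma\subseteq \operatorname{per}(G)$ whose $\mathbb{R}$-span is $\mathbb{R}^d$ such that $w(t+e)=w(e)$ for all $t\in\Gamma$ and all $e\in E$.
   Context: A graph in $\mathbb{R}^d$ is a graph $G=(V,E)$ whose vertex set $V$ is a subset of $\mathbb{R}^d$; edges are unordered pairs $uv$ of distinct vertices (simple: no loops, no multiple edges). It is locally finite if every bounded subset of $\mathbb{R}^d$ contains only finitely many vertices and every vertex has finitely many neighbours. For $t\in\mathbb{R}^d$ let $t+G$ be the graph with vertex set $t+V$ and edges $\{(t+u)(t+v): uv\in E\}$. The set of periods is $\operatorname{per}(G)=\{t\in\mathbb{R}^d : t+G=G\}$; $G$ is fully periodic if the $\mathbb{R}$-span of $\operatorname{per}(G)$ is all of $\mathbb{R}^d$. For a weight function $w:E\to\{1,2,3\}$ the weighted degree of a vertex $u$ is $s_w(u)=\sum_{uv\in E} w(uv)$; $w$ is a solution to the 1-2-3 problem if $s_w(u)\neq s_w(v)$ whenever $uv\in E$. For $t\in \operatorname{per}(G)$ and $e=uv\in E$ write $t+e=(t+u)(t+v)$. *)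

theory Defs
  imports "HOL-Analysis.Analysis"
begin

text \<open>An edge \<open>uv\<close> is the two-element set \<open>{u, v}\<close>, which rules out multiple edges; loops are
  excluded by the well-formedness condition \<open>graph_in\<close>.\<close>

record 'a ugraph =
  verts :: "'a set"
  edges :: "'a set set"

definition graph_in :: "'a ugraph \<Rightarrow> bool" where
  "graph_in G \<longleftrightarrow> (\<forall>e \<in> edges G. \<exists>u \<in> verts G. \<exists>v \<in> verts G. u \<noteq> v \<and> e = {u, v})"

definition neighbours :: "'a ugraph \<Rightarrow> 'a \<Rightarrow> 'a set" where
  "neighbours G u = {v. {u, v} \<in> edges G}"

definition graph_connected :: "'a ugraph \<Rightarrow> bool" where
  "graph_connected G \<longleftrightarrow>
     (\<forall>u \<in> verts G. \<forall>v \<in> verts G. (u, v) \<in> {(x, y). {x, y} \<in> edges G}\<^sup>*)"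

definition graph_locally_finite :: "'a::metric_space ugraph \<Rightarrow> bool" where
  "graph_locally_finite G \<longleftrightarrow>
     (\<forall>B. bounded B \<longrightarrow> finite (verts G \<inter> B)) \<and> (\<forall>u \<in> verts G. finite (neighbours G u))"

definition translate_edge :: "'a::ab_group_add \<Rightarrow> 'a set \<Rightarrow> 'a set" where
  "translate_edge t e = (\<lambda>u. t + u) ` e"

definition translate_graph :: "'a::ab_group_add \<Rightarrow> 'a ugraph \<Rightarrow> 'a ugraph" where
  "translate_graph t G =
     \<lparr>verts = (\<lambda>u. t + u) ` verts G, edges = translate_edge t ` edges G\<rparr>"

definition periods :: "'a::ab_group_add ugraph \<Rightarrow> 'a set" where
  "periods G = {t. translate_graph t G = G}"

definition fully_periodic :: "'a::real_vector ugraph \<Rightarrow> bool" where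
  "fully_periodic G \<longleftrightarrow> span (periods G) = UNIV"

definition add_subgroup :: "'a::ab_group_add set \<Rightarrow> bool" where
  "add_subgroup H \<longleftrightarrow> 0 \<in> H \<and> (\<forall>x \<in> H. \<forall>y \<in> H. x + y \<in> H) \<and> (\<forall>x \<in> H. - x \<in> H)"

text \<open>Weights are total functions on sets of points; only their values on edges matter.\<close>

definition weighted_degree :: "'a ugraph \<Rightarrow> ('a set \<Rightarrow> nat) \<Rightarrow> 'a \<Rightarrow> nat" where
  "weighted_degree G w u = (\<Sum>v \<in> neighbours G u. w {u, v})"

definition solution_123 :: "'a ugraph \<Rightarrow> ('a set \<Rightarrow> nat) \<Rightarrow> bool" where
  "solution_123 G w \<longleftrightarrow>
     w \<in> edges G \<rightarrow> {1, 2, 3} \<and>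
     (\<forall>u v. {u, v} \<in> edges G \<longrightarrow> weighted_degree G w u \<noteq> weighted_degree G w v)"

text \<open>Invariance is required only for a subgroup of the periods of \<open>G\<close> that still spans the space,
  not for all of \<open>periods G\<close>.\<close>

definition fully_periodic_weights :: "'a::real_vector ugraph \<Rightarrow> ('a set \<Rightarrow> nat) \<Rightarrow> bool" where
  "fully_periodic_weights G w \<longleftrightarrow>
     (\<exists>\<Gamma>. add_subgroup \<Gamma> \<and> \<Gamma> \<subseteq> periods G \<and> span \<Gamma> = UNIV \<and>
          (\<forall>t \<in> \<Gamma>. \<forall>e \<in> edges G. w (translate_edge t e) = w e))"

lemma translate_edge_0: "translate_edge 0 e = e"
  by (simp add: translate_edge_def)

lemma translate_edge_add: "translate_edge (s + t) e = translate_edge s (translate_edge t e)"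
  by (simp add: translate_edge_def image_image add.assoc)

lemma translate_graph_0: "translate_graph 0 G = G"
  by (simp add: translate_graph_def translate_edge_0)

lemma translate_graph_add:
  "translate_graph (s + t) G = translate_graph s (translate_graph t G)"
  by (simp add: translate_graph_def translate_edge_add image_image add.assoc)

lemma add_subgroup_periods: "add_subgroup (periods G)"
proof -
  have "translate_graph (- t) G = G" if "translate_graph t G = G" for t
    using translate_graph_add[of "- t" t G] that by (simp add: translate_graph_0)
  then show ?thesis
    by (auto simp: add_subgroup_def periods_def translate_graph_0 translate_graph_add)
qed

end

theory Submission
  imports Defs
begin

text \<open>
  Let \<open>\<Gamma>\<close> be a large even multiple of a lattice of periods. Dividing by \<open>\<Gamma>\<close> turns \<open>G\<close> into a finite
  simple connected graph \<open>Q\<close>, on which translation by half an element of \<open>\<Gamma>\<close> is a fixed-point-free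
  involution, so \<open>Q\<close> has an even number of vertices. Solutions for \<open>Q\<close> pull back to \<open>G\<close>.

  For \<open>Q\<close>, remove a non-cut vertex \<open>z\<close> whose degree is largest or smallest among its neighbours, and
  let \<open>S\<close> be a maximum cut of the rest \<open>B\<close>, with cut edges \<open>H\<close> and inner edges \<open>I\<close>. Edges at \<open>z\<close> get
  weight 3 or 1, which separates \<open>z\<close> from its neighbours. Cut edges are handled by parity: the
  edges of weight 2 form a join \<open>J\<close> that makes the weighted degree odd exactly on one side of the cut,
  which is possible because \<open>|B|\<close> is odd. Inner edges are handled by a set \<open>F \<subseteq> H\<close>, disjoint from
  \<open>J\<close> and in bijection with \<open>I\<close>, on which the weight can still be switched between 1 and 3 without
  affecting parity: a switching that separates the ends of all inner edges exists as soon as the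
  permanent of an \<open>F\<close>-by-\<open>I\<close> incidence matrix does not vanish.

  Such an \<open>F\<close> whose removal leaves \<open>B\<close> connected comes from polynomial algebra. By maximality of the
  cut, \<open>\<Prod>i\<in>I. y (h i) - y (t i)\<close> has degree at most \<open>|H \<inter> \<delta>(U)|\<close> in the direction of every vertex set
  \<open>U\<close>, and therefore is a combination of products of differences over sets \<open>F \<subseteq> H\<close> whose removal
  keeps the graph connected. Polarising at the incidence vectors of \<open>I\<close> yields a relation
  between permanents in which the one for \<open>I\<close> itself is that of a Gram matrix, hence nonzero.\<close>

section \<open>Polynomial functions along the indicator of a set\<close>

text \<open>Polynomials are kept as functions, with no normal form: degrees are only ever measured
  along lines, through \<open>shift\<close> and univariate polynomials.\<close>

inductive polyfun :: "(('v \<Rightarrow> real) \<Rightarrow> real) \<Rightarrow> bool" where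
  const: "polyfun (\<lambda>y. c)"
| coord: "polyfun (\<lambda>y. y v)"
| add: "polyfun f \<Longrightarrow> polyfun g \<Longrightarrow> polyfun (\<lambda>y. f y + g y)"
| mult: "polyfun f \<Longrightarrow> polyfun g \<Longrightarrow> polyfun (\<lambda>y. f y * g y)"

lemma polyfun_uminus: "polyfun f \<Longrightarrow> polyfun (\<lambda>y. - f y)"
  using polyfun.mult[OF polyfun.const[of "-1"]] by simp

lemma polyfun_diff: "polyfun f \<Longrightarrow> polyfun g \<Longrightarrow> polyfun (\<lambda>y. f y - g y)"
  using polyfun.add[OF _ polyfun_uminus] by fastforce

lemma polyfun_sum: "(\<And>i. i \<in> A \<Longrightarrow> polyfun (f i)) \<Longrightarrow> polyfun (\<lambda>y. \<Sum>i\<in>A. f i y)"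
  by (induction A rule: infinite_finite_induct) (auto intro: polyfun.intros)

lemma polyfun_prod: "(\<And>i. i \<in> A \<Longrightarrow> polyfun (f i)) \<Longrightarrow> polyfun (\<lambda>y. \<Prod>i\<in>A. f i y)"
  by (induction A rule: infinite_finite_induct) (auto intro: polyfun.intros)

definition shift :: "'v set \<Rightarrow> real \<Rightarrow> ('v \<Rightarrow> real) \<Rightarrow> 'v \<Rightarrow> real" where
  "shift U t y = (\<lambda>v. y v + (if v \<in> U then t else 0))"

lemma shift_0 [simp]: "shift U 0 y = y"
  by (simp add: shift_def)

text \<open>The coefficients are polynomial functions of the base point, so that a coefficient known
  to vanish at almost all points of a line can be shown to vanish at the remaining ones.\<close>

lemma polyfun_along_shift:
  assumes "polyfun g"
  shows "\<exists>p. (\<forall>y t. g (shift U t y) = poly (p y) t) \<and> (\<forall>j. polyfun (\<lambda>y. coeff (p y) j))"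
  using assms
proof induction
  case (const c)
  show ?case
    by (rule exI[of _ "\<lambda>_. [:c:]"]) (auto intro: polyfun.const)
next
  case (coord v)
  have "polyfun (\<lambda>y. coeff [:y v, c:] j)" for c j
    by (cases j) (auto simp: coeff_pCons split: nat.splits intro: polyfun.intros)
  then show ?case
    by (intro exI[of _ "\<lambda>y. [:y v, if v \<in> U then 1 else 0:]"]) (auto simp: shift_def)
next
  case (add f g)
  then obtain p q where "\<forall>y t. f (shift U t y) = poly (p y) t" "\<forall>j. polyfun (\<lambda>y. coeff (p y) j)"
    "\<forall>y t. g (shift U t y) = poly (q y) t" "\<forall>j. polyfun (\<lambda>y. coeff (q y) j)" by blast
  then show ?case
    by (intro exI[of _ "\<lambda>y. p y + q y"]) (auto intro: polyfun.intros)
next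
  case (mult f g)
  then obtain p q where "\<forall>y t. f (shift U t y) = poly (p y) t" "\<forall>j. polyfun (\<lambda>y. coeff (p y) j)"
    "\<forall>y t. g (shift U t y) = poly (q y) t" "\<forall>j. polyfun (\<lambda>y. coeff (q y) j)" by blast
  then show ?case
    by (intro exI[of _ "\<lambda>y. p y * q y"]) (auto simp: coeff_mult intro!: polyfun.mult polyfun_sum)
qed

text \<open>A factor theorem: the two values of \<open>g\<close> agree when \<open>l y = 0\<close>,
  so their difference is divisible by \<open>l\<close>. If the shift always leads to zeros of
  \<open>g\<close>, then \<open>l\<close> divides \<open>g\<close> itself.\<close>

lemma polyfun_shift_diff:
  assumes "polyfun g" "polyfun l"
  shows "\<exists>q. polyfun q \<and> (\<forall>y. g (shift U (l y) y) = g y + l y * q y)"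
  using assms(1)
proof induction
  case (const c)
  show ?case by (rule exI[of _ "\<lambda>_. 0"]) (auto intro: polyfun.const)
next
  case (coord v)
  show ?case
    by (rule exI[of _ "\<lambda>_. if v \<in> U then 1 else 0"]) (auto simp: shift_def intro: polyfun.const)
next
  case (add f g)
  then obtain p q where "polyfun p" "\<forall>y. f (shift U (l y) y) = f y + l y * p y"
    "polyfun q" "\<forall>y. g (shift U (l y) y) = g y + l y * q y" by blast
  then show ?case
    by (intro exI[of _ "\<lambda>y. p y + q y"]) (auto simp: algebra_simps intro: polyfun.intros)
next
  case (mult f g)
  then obtain p q where "polyfun p" "\<forall>y. f (shift U (l y) y) = f y + l y * p y"
    "polyfun q" "\<forall>y. g (shift U (l y) y) = g y + l y * q y" by blast
  with mult.hyps assms(2) show ?case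
    by (intro exI[of _ "\<lambda>y. p y * (g y + l y * q y) + f y * q y"])
      (auto simp: algebra_simps intro!: polyfun.intros)
qed

text \<open>The bound is strict so that \<open>k = 0\<close> can express vanishing along the whole
  line and \<open>k = 1\<close> being constant on it.\<close>

definition deg_less :: "'v set \<Rightarrow> nat \<Rightarrow> (('v \<Rightarrow> real) \<Rightarrow> real) \<Rightarrow> ('v \<Rightarrow> real) \<Rightarrow> bool" where
  "deg_less U k g y \<longleftrightarrow> (\<exists>p. (\<forall>t. g (shift U t y) = poly p t) \<and> (\<forall>j\<ge>k. coeff p j = 0))"

lemma deg_less_unique:
  assumes "deg_less U k g y" "\<And>t. g (shift U t y) = poly p t" "j \<ge> k"
  shows "coeff p j = 0"
proof -
  obtain q where q: "\<forall>t. g (shift U t y) = poly q t" "\<forall>j\<ge>k. coeff q j = 0"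
    using assms(1) by (auto simp: deg_less_def)
  have "poly p = poly q" using assms(2) q(1) by (auto simp: fun_eq_iff)
  then show ?thesis using q(2) assms(3) by (simp add: poly_eq_poly_eq_iff)
qed

lemma deg_less_diff:
  assumes "deg_less U k f y" "deg_less U k g y"
  shows "deg_less U k (\<lambda>y. f y - g y) y"
proof -
  obtain p q where "\<forall>t. f (shift U t y) = poly p t" "\<forall>j\<ge>k. coeff p j = 0"
    "\<forall>t. g (shift U t y) = poly q t" "\<forall>j\<ge>k. coeff q j = 0"
    using assms by (auto simp: deg_less_def)
  then show ?thesis unfolding deg_less_def
    by (intro exI[of _ "p - q"]) auto
qed

lemma deg_less_cmult: "deg_less U k g y \<Longrightarrow> deg_less U k (\<lambda>y. c * g y) y"
proof -
  assume "deg_less U k g y"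
  then obtain p where "\<forall>t. g (shift U t y) = poly p t" "\<forall>j\<ge>k. coeff p j = 0"
    by (auto simp: deg_less_def)
  then show ?thesis unfolding deg_less_def by (intro exI[of _ "smult c p"]) auto
qed

lemma deg_less_sum:
  assumes "\<And>i. i \<in> A \<Longrightarrow> deg_less U k (g i) y"
  shows "deg_less U k (\<lambda>y. \<Sum>i\<in>A. g i y) y"
proof -
  have "\<forall>i\<in>A. \<exists>p. (\<forall>t. g i (shift U t y) = poly p t) \<and> (\<forall>j\<ge>k. coeff p j = 0)"
    using assms by (auto simp: deg_less_def)
  then obtain p where "\<forall>i\<in>A. (\<forall>t. g i (shift U t y) = poly (p i) t) \<and> (\<forall>j\<ge>k. coeff (p i) j = 0)"
    by metis
  then show ?thesis unfolding deg_less_def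
    by (intro exI[of _ "\<Sum>i\<in>A. p i"]) (auto simp: poly_sum coeff_sum)
qed

lemma deg_less_mono: "deg_less U k g y \<Longrightarrow> k \<le> k' \<Longrightarrow> deg_less U k' g y"
  by (auto simp: deg_less_def)

lemma deg_less_0: "deg_less U 0 g y \<Longrightarrow> g y = 0"
proof -
  assume "deg_less U 0 g y"
  then obtain p where p: "\<forall>t. g (shift U t y) = poly p t" "\<forall>j\<ge>0. coeff p j = 0"
    by (auto simp: deg_less_def)
  then have "p = 0" by (auto simp: poly_eq_iff)
  with p(1)[rule_format, of 0] show "g y = 0" by simp
qed

lemma deg_less_1: "deg_less U 1 g y \<Longrightarrow> g (shift U t y) = g y"
proof -
  assume "deg_less U 1 g y"
  then obtain p where p: "\<forall>t. g (shift U t y) = poly p t" "\<forall>j\<ge>1. coeff p j = 0"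
    by (auto simp: deg_less_def)
  then have "degree p = 0" by (metis degree_0 leading_coeff_neq_0 less_one not_less)
  then obtain c where "p = [:c:]" by (metis degree_eq_zeroE)
  with p(1)[rule_format, of 0] p(1)[rule_format, of t] show ?thesis by simp
qed

section \<open>Expansion into products of tensions\<close>

text \<open>Graphs are given by a set of edges with end points \<open>h e\<close> and \<open>t e\<close>. Edges in \<open>C\<close> are to be
  thought of as contracted: \<open>potentials V h t C\<close> are the functions on the contracted graph, and
  saturated sets are its vertex sets.\<close>

definition crosses :: "('e \<Rightarrow> 'v) \<Rightarrow> ('e \<Rightarrow> 'v) \<Rightarrow> 'v set \<Rightarrow> 'e \<Rightarrow> bool" where
  "crosses h t U e \<longleftrightarrow> (h e \<in> U) \<noteq> (t e \<in> U)"

definition cut_connected :: "'v set \<Rightarrow> ('e \<Rightarrow> 'v) \<Rightarrow> ('e \<Rightarrow> 'v) \<Rightarrow> 'e set \<Rightarrow> bool" where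
  "cut_connected V h t E \<longleftrightarrow> (\<forall>U. U \<noteq> {} \<longrightarrow> U \<subset> V \<longrightarrow> (\<exists>e\<in>E. crosses h t U e))"

definition potentials :: "'v set \<Rightarrow> ('e \<Rightarrow> 'v) \<Rightarrow> ('e \<Rightarrow> 'v) \<Rightarrow> 'e set \<Rightarrow> ('v \<Rightarrow> real) set" where
  "potentials V h t C = {y. (\<forall>v. v \<notin> V \<longrightarrow> y v = 0) \<and> (\<forall>e\<in>C. y (h e) = y (t e))}"

definition saturated :: "'v set \<Rightarrow> ('e \<Rightarrow> 'v) \<Rightarrow> ('e \<Rightarrow> 'v) \<Rightarrow> 'e set \<Rightarrow> 'v set \<Rightarrow> bool" where
  "saturated V h t C U \<longleftrightarrow> U \<noteq> {} \<and> U \<subseteq> V \<and> (\<forall>e\<in>C. \<not> crosses h t U e)"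

definition tension_prod :: "('e \<Rightarrow> 'v) \<Rightarrow> ('e \<Rightarrow> 'v) \<Rightarrow> 'e set \<Rightarrow> ('v \<Rightarrow> real) \<Rightarrow> real" where
  "tension_prod h t F y = (\<Prod>e\<in>F. y (h e) - y (t e))"

text \<open>A strict bound on the degree in direction \<open>U\<close>. The degree may reach the
  number of crossing edges of \<open>E\<close> if \<open>U\<close> is \<open>V\<close> or an edge of
  \<open>I\<close> crosses; otherwise it must stay below, because a set \<open>F\<close> whose
  removal preserves connectivity has to spare a crossing edge.\<close>

definition cut_bound :: "'v set \<Rightarrow> ('e \<Rightarrow> 'v) \<Rightarrow> ('e \<Rightarrow> 'v) \<Rightarrow> 'e set \<Rightarrow> 'e set \<Rightarrow> 'v set \<Rightarrow> nat" where
  "cut_bound V h t I E U =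
     card {e \<in> E. crosses h t U e} + (if U = V \<or> (\<exists>e\<in>I. crosses h t U e) then 1 else 0)"

lemma polyfun_tension: "polyfun (\<lambda>y. y a - y b)"
  by (intro polyfun_diff polyfun.coord)

lemma polyfun_tension_prod: "polyfun (tension_prod h t F)"
proof -
  have "polyfun (\<lambda>y. \<Prod>e\<in>F. y (h e) - y (t e))"
    by (intro polyfun_prod polyfun_tension)
  then show ?thesis by (simp add: tension_prod_def[abs_def])
qed

lemma shift_potentials:
  "y \<in> potentials V h t C \<Longrightarrow> saturated V h t C U \<Longrightarrow> shift U s y \<in> potentials V h t C"
  by (auto simp: potentials_def saturated_def shift_def crosses_def)

text \<open>Each factor is linear in the shift parameter, and constant in it unless its edge crosses
  \<open>U\<close>.\<close>

lemma deg_less_tension_prod: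
  assumes "finite F"
  shows "deg_less U (Suc (card {e \<in> F. crosses h t U e})) (tension_prod h t F) y"
proof -
  define d where "d e = (if h e \<in> U then 1 else 0) - (if t e \<in> U then 1 else 0 :: real)" for e
  define p where "p = (\<Prod>e\<in>F. [:y (h e) - y (t e), d e:])"
  have "tension_prod h t F (shift U s y) = poly p s" for s
    unfolding p_def tension_prod_def poly_prod
    by (intro prod.cong) (auto simp: shift_def d_def algebra_simps)
  moreover have "degree p \<le> card {e \<in> F. crosses h t U e}"
  proof -
    have "degree p \<le> (\<Sum>e\<in>F. degree [:y (h e) - y (t e), d e:])"
      using degree_prod_sum_le[OF assms, of "\<lambda>e. [:y (h e) - y (t e), d e:]"]
      by (simp only: p_def o_def)
    also have "\<dots> \<le> (\<Sum>e\<in>F. if crosses h t U e then 1 else 0)"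
      by (intro sum_mono) (auto simp: d_def crosses_def)
    also have "\<dots> = card {e \<in> F. crosses h t U e}"
      using assms by (simp flip: sum.inter_filter)
    finally show ?thesis .
  qed
  then have "\<forall>j\<ge>Suc (card {e \<in> F. crosses h t U e}). coeff p j = 0"
    by (auto intro!: coeff_eq_0)
  ultimately show ?thesis unfolding deg_less_def by blast
qed

text \<open>The level sets of a potential are saturated, so its nonzero values can be cleared one
  after another by shifts that preserve \<open>g\<close>.\<close>

lemma constant_on_potentials:
  assumes "finite V"
    and const: "\<And>U y s. saturated V h t C U \<Longrightarrow> y \<in> potentials V h t C \<Longrightarrow> g (shift U s y) = g y"
    and "y \<in> potentials V h t C" and C: "\<And>e. e \<in> C \<Longrightarrow> h e \<in> V \<and> t e \<in> V"
  shows "g y = g (\<lambda>_. 0)"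
  using assms(3)
proof (induction "card {v \<in> V. y v \<noteq> 0}" arbitrary: y rule: less_induct)
  case less
  show ?case
  proof (cases "\<exists>v\<in>V. y v \<noteq> 0")
    case False
    then have "y = (\<lambda>_. 0)" using less.prems by (auto simp: potentials_def)
    then show ?thesis by simp
  next
    case True
    then obtain v where v: "v \<in> V" "y v \<noteq> 0" by blast
    define U where "U = {u \<in> V. y u = y v}"
    have U: "saturated V h t C U"
      using v less.prems C by (auto simp: saturated_def U_def crosses_def potentials_def)
    let ?z = "shift U (- y v) y"
    have z: "?z \<in> potentials V h t C" using shift_potentials[OF less.prems U] .
    have "card {u \<in> V. ?z u \<noteq> 0} < card {u \<in> V. y u \<noteq> 0}"
      by (rule psubset_card_mono) (use \<open>finite V\<close> v in \<open>auto simp: shift_def U_def\<close>)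
    from less.hyps[OF this z] have "g ?z = g (\<lambda>_. 0)" .
    moreover have "g ?z = g y" using const[OF U less.prems] .
    ultimately show ?thesis by simp
  qed
qed

lemma cut_connectedD:
  assumes "cut_connected V h t A" "U \<noteq> {}" "U \<subset> V"
  obtains x where "x \<in> A" "crosses h t U x"
  using assms unfolding cut_connected_def by blast

text \<open>If \<open>e\<close> crosses \<open>U\<close>, the factor
  \<open>y (h e) - y (t e)\<close> has degree exactly 1 along the line, so the quotient loses a
  degree. Otherwise it is constant along the line; where that constant is nonzero it cancels, and
  where it is zero a detour in direction \<open>W\<close> helps.\<close>

lemma deg_less_divide:
  assumes q: "polyfun q" and g: "\<And>y. y \<in> potentials V h t C \<Longrightarrow> g y = (y (h e) - y (t e)) * q y"
    and deg: "\<And>y. y \<in> potentials V h t C \<Longrightarrow> deg_less U k g y"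
    and U: "saturated V h t C U" and W: "saturated V h t C W" "h e \<in> W" "t e \<notin> W"
    and y: "y \<in> potentials V h t C"
  shows "deg_less U (if crosses h t U e then k - 1 else k) q y"
proof -
  obtain p where p: "\<And>y t. q (shift U t y) = poly (p y) t" "\<And>j. polyfun (\<lambda>y. coeff (p y) j)"
    using polyfun_along_shift[OF q] by blast
  define d where "d = (if h e \<in> U then 1 else 0) - (if t e \<in> U then 1 else 0 :: real)"
  have gp: "g (shift U s y) = poly ([:y (h e) - y (t e), d:] * p y) s"
    if "y \<in> potentials V h t C" for y s
  proof -
    have "shift U s y (h e) - shift U s y (t e) = poly [:y (h e) - y (t e), d:] s"
      by (simp add: shift_def d_def algebra_simps)
    then show ?thesis using g[OF shift_potentials[OF that U], of s] p(1)[of s y]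
      by (simp only: poly_mult)
  qed
  have z: "coeff ([:y (h e) - y (t e), d:] * p y) j = 0"
    if "y \<in> potentials V h t C" "j \<ge> k" for y j
    using deg_less_unique[OF deg[OF that(1)] gp[OF that(1)] that(2)] .
  show ?thesis
  proof (cases "crosses h t U e")
    case True
    then have d: "d \<noteq> 0" by (auto simp: d_def crosses_def)
    have "coeff (p y) j = 0" if j: "j \<ge> k - 1" for j
    proof (rule ccontr)
      assume nz: "coeff (p y) j \<noteq> 0"
      then have nz': "p y \<noteq> 0" by auto
      from d have l: "[:y (h e) - y (t e), d:] \<noteq> 0" "degree [:y (h e) - y (t e), d:] = 1"
        by auto
      have dg: "degree ([:y (h e) - y (t e), d:] * p y) = Suc (degree (p y))"
        by (simp only: degree_mult_eq[OF l(1) nz'] l(2) plus_1_eq_Suc)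
      have "j \<le> degree (p y)" using nz by (rule le_degree)
      then have "Suc (degree (p y)) \<ge> k" using j by linarith
      from z[OF y this] dg have "[:y (h e) - y (t e), d:] * p y = 0"
        by (metis leading_coeff_0_iff)
      with l(1) nz' show False by (metis mult_eq_0_iff)
    qed
    then show ?thesis using True p(1) by (auto simp: deg_less_def)
  next
    case False
    then have d: "d = 0" by (auto simp: d_def crosses_def)
    have "coeff (p y) j = 0" if j: "j \<ge> k" for j
    proof -
      \<comment> \<open>Along direction \<open>W\<close> the factor vanishes at a single parameter
        only. Elsewhere the coefficient of \<open>q\<close> vanishes, so as a polynomial in
        \<open>s\<close> it is 0, also at \<open>s = 0\<close>.\<close>
      obtain r where r: "\<And>s. coeff (p (shift W s y)) j = poly r s"
        using polyfun_along_shift[OF p(2)[of j], of W] by blast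
      have "poly r s = 0" if "s \<noteq> y (t e) - y (h e)" for s
      proof -
        have "shift W s y (h e) - shift W s y (t e) \<noteq> 0"
          using that W by (simp add: shift_def algebra_simps)
        with z[OF shift_potentials[OF y W(1)] j, of s] d r[of s] show ?thesis by simp
      qed
      then have "UNIV - {y (t e) - y (h e)} \<subseteq> {s. poly r s = 0}" by auto
      moreover have "infinite (UNIV - {y (t e) - y (h e)} :: real set)"
        by (simp add: infinite_UNIV_char_0)
      ultimately have "r = 0" using finite_subset poly_roots_finite by blast
      with r[of 0] show ?thesis by simp
    qed
    then show ?thesis using False p(1) by (auto simp: deg_less_def)
  qed
qed

text \<open>By deletion and contraction of an edge \<open>e\<close>: subtracting the expansion for the graph with \<open>e\<close>
  contracted leaves a function that vanishes when \<open>y (h e) = y (t e)\<close>, and its quotient by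
  \<open>y (h e) - y (t e)\<close> satisfies the degree bounds for the graph with \<open>e\<close> deleted.\<close>

lemma tension_expansion:
  assumes "finite V" "finite E" and "\<And>e. e \<in> C \<union> E \<Longrightarrow> h e \<in> V \<and> t e \<in> V" and "polyfun g"
    and "\<And>U y. saturated V h t C U \<Longrightarrow> y \<in> potentials V h t C \<Longrightarrow>
           deg_less U (cut_bound V h t I E U) g y"
  shows "\<exists>c. (\<forall>F. c F \<noteq> 0 \<longrightarrow> F \<subseteq> E \<and> cut_connected V h t (C \<union> (E - F) \<union> I)) \<and>
           (\<forall>y\<in>potentials V h t C. g y = (\<Sum>F\<in>Pow E. c F * tension_prod h t F y))"
  using assms(2-)
proof (induction E arbitrary: C g rule: finite_induct)
  case empty
  \<comment> \<open>With no edge left in \<open>E\<close> the bounds are 0 or 1. If the graph is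
    connected all are 1 and \<open>g\<close> is constant; otherwise some separating \<open>U\<close>
    has bound 0 and \<open>g\<close> vanishes.\<close>
  show ?case
  proof (cases "cut_connected V h t (C \<union> I)")
    case True
    have "g (shift U s y) = g y" if "saturated V h t C U" "y \<in> potentials V h t C" for U y s
    proof -
      have "U = V \<or> (\<exists>e\<in>I. crosses h t U e)"
        using that(1) True unfolding saturated_def cut_connected_def by blast
      then show ?thesis
        using empty.prems(3)[OF that] by (intro deg_less_1) (simp add: cut_bound_def)
    qed
    then have "g y = g (\<lambda>_. 0)" if "y \<in> potentials V h t C" for y
      using constant_on_potentials[OF assms(1) _ that] empty.prems(1) by blast
    then show ?thesis using True
      by (intro exI[of _ "\<lambda>F. if F = {} then g (\<lambda>_. 0) else 0"]) (auto simp: tension_prod_def)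
  next
    case False
    then obtain U where U: "U \<noteq> {}" "U \<subset> V" "\<forall>e\<in>C \<union> I. \<not> crosses h t U e"
      by (auto simp: cut_connected_def)
    have g0: "g y = 0" if "y \<in> potentials V h t C" for y
    proof (rule deg_less_0[of U g y])
      have sat: "saturated V h t C U" and b: "cut_bound V h t I {} U = 0"
        using U by (auto simp: saturated_def cut_bound_def)
      show "deg_less U 0 g y" using empty.prems(3)[OF sat that] unfolding b .
    qed
    show ?thesis using g0 by (intro exI[of _ "\<lambda>_. 0"]) simp
  qed
next
  case (insert e E)
  define X where "X F \<longleftrightarrow> cut_connected V h t (C \<union> (insert e E - F) \<union> I)" for F
  have sub: "potentials V h t (insert e C) \<subseteq> potentials V h t C" by (auto simp: potentials_def)
  have bound: "cut_bound V h t I (insert e E) U =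
      (if crosses h t U e then Suc (cut_bound V h t I E U) else cut_bound V h t I E U)" for U
  proof -
    have "{x \<in> insert e E. crosses h t U x} =
      (if crosses h t U e then insert e {x \<in> E. crosses h t U x} else {x \<in> E. crosses h t U x})"
      by auto
    then show ?thesis using insert.hyps by (simp add: cut_bound_def)
  qed
  have "\<exists>c. (\<forall>F. c F \<noteq> 0 \<longrightarrow> F \<subseteq> E \<and> cut_connected V h t (insert e C \<union> (E - F) \<union> I)) \<and>
           (\<forall>y\<in>potentials V h t (insert e C). g y = (\<Sum>F\<in>Pow E. c F * tension_prod h t F y))"
  proof (rule insert.IH)
    show "\<And>U y. saturated V h t (insert e C) U \<Longrightarrow> y \<in> potentials V h t (insert e C) \<Longrightarrow>
           deg_less U (cut_bound V h t I E U) g y"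
    proof -
      fix U y assume U: "saturated V h t (insert e C) U" and y: "y \<in> potentials V h t (insert e C)"
      have "saturated V h t C U" "\<not> crosses h t U e" using U by (auto simp: saturated_def)
      then show "deg_less U (cut_bound V h t I E U) g y"
        using insert.prems(3)[of U y] y sub bound[of U] by auto
    qed
    show "h x \<in> V \<and> t x \<in> V" if "x \<in> insert e C \<union> E" for x
      using insert.prems(1)[of x] that by blast
    show "polyfun g" by (rule insert.prems(2))
  qed
  then obtain c where c:
    "\<forall>F. c F \<noteq> 0 \<longrightarrow> F \<subseteq> E \<and> cut_connected V h t (insert e C \<union> (E - F) \<union> I)"
    "\<forall>y\<in>potentials V h t (insert e C). g y = (\<Sum>F\<in>Pow E. c F * tension_prod h t F y)"
    by (elim exE conjE)
  note c = c[rule_format]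
  have cX: "X F" if "c F \<noteq> 0" for F
  proof -
    have F: "F \<subseteq> E" by (rule conjunct1[OF c(1)[OF that]])
    have F2: "cut_connected V h t (insert e C \<union> (E - F) \<union> I)" by (rule conjunct2[OF c(1)[OF that]])
    have "e \<notin> F" using F insert.hyps(2) by blast
    then have "insert e C \<union> (E - F) = C \<union> (insert e E - F)" by blast
    then show ?thesis using F2 unfolding X_def by (rule subst)
  qed
  define g1 where "g1 y = g y - (\<Sum>F\<in>Pow E. c F * tension_prod h t F y)" for y
  have g1_poly: "polyfun g1"
    unfolding g1_def by (intro polyfun_diff polyfun_sum polyfun.mult polyfun.const
        polyfun_tension_prod insert.prems)
  have g1_deg: "deg_less U (cut_bound V h t I (insert e E) U) g1 y"
    if U: "saturated V h t C U" and y: "y \<in> potentials V h t C" for U y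
    unfolding g1_def
  proof (intro deg_less_diff deg_less_sum)
    show "deg_less U (cut_bound V h t I (insert e E) U) g y"
      using insert.prems(3)[OF U y] .
    fix F assume F: "F \<in> Pow E"
    show "deg_less U (cut_bound V h t I (insert e E) U) (\<lambda>y. c F * tension_prod h t F y) y"
    proof (cases "c F = 0")
      case True
      then show ?thesis by (auto simp: deg_less_def intro!: exI[of _ 0])
    next
      case False
      have fin: "finite {x \<in> insert e E. crosses h t U x}" using insert.hyps by simp
      have le: "card {x \<in> F. crosses h t U x} \<le> card {x \<in> insert e E. crosses h t U x}"
        using fin F by (intro card_mono) auto
      have "card {x \<in> F. crosses h t U x} < cut_bound V h t I (insert e E) U"
      proof (cases "U = V \<or> (\<exists>i\<in>I. crosses h t U i)")
        case True
        then show ?thesis using le by (auto simp: cut_bound_def)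
      next
        case noI: False
        with U have U2: "U \<noteq> {}" "U \<subset> V" by (auto simp: saturated_def)
        \<comment> \<open>Here the bound lacks the extra 1. It is still met because connectivity
          puts an edge across \<open>U\<close>, and this edge can only lie in
          \<open>insert e E\<close> outside \<open>F\<close>.\<close>
        obtain x where x: "x \<in> C \<union> (insert e E - F) \<union> I" "crosses h t U x"
          using cut_connectedD[OF cX[OF False, unfolded X_def] U2] .
        have "x \<notin> C" using U x(2) by (auto simp: saturated_def)
        moreover have "x \<notin> I" using noI x(2) by blast
        ultimately have "x \<in> insert e E - F" "crosses h t U x" using x by blast+
        then have "{x \<in> F. crosses h t U x} \<subset> {x \<in> insert e E. crosses h t U x}" using F by blast
        from psubset_card_mono[OF fin this] show ?thesis by (auto simp: cut_bound_def intro: less_SucI)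
      qed
      then have "Suc (card {x \<in> F. crosses h t U x}) \<le> cut_bound V h t I (insert e E) U" by simp
      moreover have "finite F" using F insert.hyps finite_subset by auto
      ultimately show ?thesis
        using deg_less_mono[OF deg_less_tension_prod] by (intro deg_less_cmult) blast
    qed
  qed
  \<comment> \<open>the vertex of the contracted graph that contains \<open>h e\<close>\<close>
  define W where "W = {v \<in> V. \<forall>U. saturated V h t C U \<longrightarrow> h e \<in> U \<longrightarrow> v \<in> U}"
  have V_sat: "saturated V h t C V"
    using insert.prems(1) by (auto simp: saturated_def crosses_def)
  have W: "saturated V h t C W" "h e \<in> W"
  proof -
    show "h e \<in> W" using insert.prems(1) by (auto simp: W_def)
    have "h x \<in> W \<longleftrightarrow> t x \<in> W" if "x \<in> C" for x
      using that insert.prems(1) unfolding W_def saturated_def crosses_def by blast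
    with \<open>h e \<in> W\<close> show "saturated V h t C W" by (auto simp: saturated_def crosses_def W_def)
  qed
  have "\<exists>d. (\<forall>F. d F \<noteq> 0 \<longrightarrow> F \<subseteq> E \<and> X (insert e F)) \<and>
      (\<forall>y\<in>potentials V h t C. g1 y = (y (h e) - y (t e)) * (\<Sum>F\<in>Pow E. d F * tension_prod h t F y))"
  proof (cases "t e \<in> W")
    \<comment> \<open>In this case \<open>e\<close> is a loop of the contracted graph: level sets of
      potentials are saturated, so its ends always have equal values and \<open>g1\<close>
      vanishes.\<close>
    case True
    have "y (h e) = y (t e)" if y: "y \<in> potentials V h t C" for y
    proof -
      have "saturated V h t C {v \<in> V. y v = y (h e)}"
        using y insert.prems(1) by (auto simp: saturated_def potentials_def crosses_def)
      with True insert.prems(1) show ?thesis by (auto simp: W_def)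
    qed
    then have "y \<in> potentials V h t (insert e C)" if "y \<in> potentials V h t C" for y
      using that by (auto simp: potentials_def)
    then have "g1 y = 0" if "y \<in> potentials V h t C" for y
      using c(2) that by (auto simp: g1_def)
    then show ?thesis by (intro exI[of _ "\<lambda>_. 0"]) auto
  next
    case False
    \<comment> \<open>Moving the block \<open>W\<close> alone by \<open>y (t e) - y (h e)\<close>
      gives \<open>e\<close> equal ends, and there \<open>g1\<close> vanishes by the expansion for
      the contracted graph.\<close>
    obtain q0 where q0: "polyfun q0"
      "\<And>y. g1 (shift W (y (t e) - y (h e)) y) = g1 y + (y (t e) - y (h e)) * q0 y"
      using polyfun_shift_diff[OF g1_poly polyfun_tension, of W "t e" "h e"] by blast
    have q0_eq: "g1 y = (y (h e) - y (t e)) * q0 y" if y: "y \<in> potentials V h t C" for y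
    proof -
      let ?z = "shift W (y (t e) - y (h e)) y"
      have "?z (h e) = ?z (t e)" using W(2) False by (simp add: shift_def)
      then have "?z \<in> potentials V h t (insert e C)"
        using shift_potentials[OF y W(1), of "y (t e) - y (h e)"] by (simp add: potentials_def)
      then have "g1 ?z = 0" using c(2) by (simp add: g1_def)
      with q0(2)[of y] show ?thesis by (simp add: algebra_simps)
    qed
    have "\<exists>d. (\<forall>F. d F \<noteq> 0 \<longrightarrow> F \<subseteq> E \<and> cut_connected V h t (C \<union> (E - F) \<union> I)) \<and>
           (\<forall>y\<in>potentials V h t C. q0 y = (\<Sum>F\<in>Pow E. d F * tension_prod h t F y))"
    proof (rule insert.IH)
      fix U y assume U: "saturated V h t C U" and y: "y \<in> potentials V h t C"
      have "deg_less U (if crosses h t U e then cut_bound V h t I (insert e E) U - 1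
          else cut_bound V h t I (insert e E) U) q0 y"
        using deg_less_divide[OF q0(1) q0_eq g1_deg[OF U] U W False y] .
      then show "deg_less U (cut_bound V h t I E U) q0 y"
        using bound[of U] by (simp split: if_splits)
    next
      show "h x \<in> V \<and> t x \<in> V" if "x \<in> C \<union> E" for x
        using insert.prems(1)[of x] that by blast
    qed (rule q0(1))
    then obtain d where d: "\<forall>F. d F \<noteq> 0 \<longrightarrow> F \<subseteq> E \<and> cut_connected V h t (C \<union> (E - F) \<union> I)"
      "\<forall>y\<in>potentials V h t C. q0 y = (\<Sum>F\<in>Pow E. d F * tension_prod h t F y)"
      by (elim exE conjE)
    note d = d[rule_format]
    have "X (insert e F)" if "d F \<noteq> 0" for F
    proof -
      have "insert e E - insert e F = E - F" using insert.hyps by auto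
      with d(1)[OF that] show ?thesis by (simp add: X_def)
    qed
    with d q0_eq show ?thesis by (intro exI[of _ d]) auto
  qed
  then obtain d where d: "\<forall>F. d F \<noteq> 0 \<longrightarrow> F \<subseteq> E \<and> X (insert e F)"
    "\<forall>y\<in>potentials V h t C.
       g1 y = (y (h e) - y (t e)) * (\<Sum>F\<in>Pow E. d F * tension_prod h t F y)"
    by (elim exE conjE)
  note d = d[rule_format]
  \<comment> \<open>Terms without \<open>e\<close> come from the contraction, terms with
    \<open>e\<close> from the quotient, whose cofactor supplies the missing tension of
    \<open>e\<close>.\<close>
  define b where "b F = (if e \<in> F then d (F - {e}) else c F)" for F
  have "F \<subseteq> insert e E \<and> X F" if b: "b F \<noteq> 0" for F
  proof (cases "e \<in> F")
    case True
    then have "d (F - {e}) \<noteq> 0" using b by (simp add: b_def)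
    from d(1)[OF this] True show ?thesis by (auto simp: insert_absorb)
  next
    case False
    then have "c F \<noteq> 0" using b by (simp add: b_def)
    from c(1)[OF this] cX[OF this] show ?thesis by auto
  qed
  moreover have "g y = (\<Sum>F\<in>Pow (insert e E). b F * tension_prod h t F y)"
    if y: "y \<in> potentials V h t C" for y
  proof -
    have inj: "inj_on (insert e) (Pow E)" using insert.hyps by (auto simp: inj_on_def)
    have "(\<Sum>F\<in>Pow (insert e E). b F * tension_prod h t F y) =
        (\<Sum>F\<in>Pow E. b F * tension_prod h t F y) + (\<Sum>F\<in>insert e ` Pow E. b F * tension_prod h t F y)"
      unfolding Pow_insert using insert.hyps by (intro sum.union_disjoint) auto
    also have "(\<Sum>F\<in>Pow E. b F * tension_prod h t F y) = (\<Sum>F\<in>Pow E. c F * tension_prod h t F y)"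
      using insert.hyps by (intro sum.cong) (auto simp: b_def)
    also have "(\<Sum>F\<in>insert e ` Pow E. b F * tension_prod h t F y) =
        (\<Sum>F\<in>Pow E. b (insert e F) * tension_prod h t (insert e F) y)"
      by (simp add: sum.reindex[OF inj])
    also have "\<dots> = (\<Sum>F\<in>Pow E. (y (h e) - y (t e)) * (d F * tension_prod h t F y))"
    proof (intro sum.cong refl)
      fix F assume "F \<in> Pow E"
      then have "e \<notin> F" "finite F" using insert.hyps finite_subset by auto
      then show "b (insert e F) * tension_prod h t (insert e F) y =
          (y (h e) - y (t e)) * (d F * tension_prod h t F y)"
        by (simp add: b_def tension_prod_def)
    qed
    also have "\<dots> = g1 y" by (simp add: d(2)[OF y] sum_distrib_left)
    finally show ?thesis by (simp add: g1_def)
  qed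
  ultimately show ?case unfolding X_def by (intro exI[of _ b]) auto
qed

section \<open>Permanents\<close>

definition permanent :: "'i set \<Rightarrow> ('i \<Rightarrow> 'i \<Rightarrow> real) \<Rightarrow> real" where
  "permanent N a = (\<Sum>p | p permutes N. \<Prod>k\<in>N. a (p k) k)"

lemma permanent_transpose: "permanent N (\<lambda>i k. a k i) = permanent N a"
proof -
  have "permanent N (\<lambda>i k. a k i) = (\<Sum>p | p permutes N. \<Prod>k\<in>N. a k (inv p k))"
    unfolding permanent_def by (rule sum_permutations_inverse)
  also have "\<dots> = permanent N a" unfolding permanent_def
  proof (intro sum.cong refl)
    fix p assume "p \<in> {p. p permutes N}"
    then have p: "p permutes N" by simp
    have "(\<Prod>k\<in>N. a k (inv p k)) = (\<Prod>k\<in>N. a (p k) (inv p (p k)))"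
      by (rule prod.reindex_bij_betw[symmetric]) (rule permutes_imp_bij[OF p])
    then show "(\<Prod>k\<in>N. a k (inv p k)) = (\<Prod>k\<in>N. a (p k) k)"
      by (simp add: permutes_inverses[OF p])
  qed
  finally show ?thesis .
qed

lemma permanent_permute_columns:
  assumes "q permutes N"
  shows "permanent N (\<lambda>i k. a i (q k)) = permanent N a"
proof -
  have "permanent N (\<lambda>i k. a i (q k)) = (\<Sum>p | p permutes N. \<Prod>k\<in>N. a ((p \<circ> q) k) (q k))"
    unfolding permanent_def by (rule sum_permutations_compose_right[OF assms])
  also have "\<dots> = permanent N a" unfolding permanent_def o_def
    by (intro sum.cong refl prod.reindex_bij_betw permutes_imp_bij[OF assms])
  finally show ?thesis .
qed

text \<open>Ryser's formula; the constants \<open>c\<close> drop out because only bijections survive the alternating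
  sum.\<close>

lemma alternating_sum_prod:
  fixes a :: "'i \<Rightarrow> 'i \<Rightarrow> real"
  assumes "finite N"
  shows "(\<Sum>A\<in>Pow N. (- 1) ^ card (N - A) * (\<Prod>i\<in>N. c i + (\<Sum>k\<in>A. a i k))) = permanent N a"
proof -
  \<comment> \<open>In the expanded product, the choice \<open>None\<close> takes the constant
    \<open>c i\<close> and \<open>Some k\<close> takes the entry in column \<open>k\<close>.\<close>
  define b where "b i x = (case x of None \<Rightarrow> c i | Some k \<Rightarrow> a i k)" for i x
  define Opt where "Opt = insert None (Some ` N)"
  define Ph where "Ph = PiE N (\<lambda>_. Opt)"
  have fin: "finite Ph" using assms by (auto simp: Ph_def Opt_def intro!: finite_PiE)
  have expand: "(\<Prod>i\<in>N. c i + (\<Sum>k\<in>A. a i k)) =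
      (\<Sum>f\<in>Ph. if \<forall>k. Some k \<in> f ` N \<longrightarrow> k \<in> A then \<Prod>i\<in>N. b i (f i) else 0)" if A: "A \<in> Pow N" for A
  proof -
    have "c i + (\<Sum>k\<in>A. a i k) = (\<Sum>x\<in>Opt. if \<forall>k. x = Some k \<longrightarrow> k \<in> A then b i x else 0)" for i
    proof -
      have "(\<Sum>x\<in>Opt. if \<forall>k. x = Some k \<longrightarrow> k \<in> A then b i x else 0) =
          c i + (\<Sum>x\<in>Some ` N. if \<forall>k. x = Some k \<longrightarrow> k \<in> A then b i x else 0)"
        unfolding Opt_def using assms by (subst sum.insert) (auto simp: b_def)
      also have "(\<Sum>x\<in>Some ` N. if \<forall>k. x = Some k \<longrightarrow> k \<in> A then b i x else 0) =
          (\<Sum>k\<in>N. if k \<in> A then a i k else 0)"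
        by (simp add: sum.reindex b_def cong: if_cong)
      also have "\<dots> = (\<Sum>k\<in>A. a i k)"
        using A assms by (simp add: sum.inter_restrict[symmetric] Int_absorb1)
      finally show ?thesis by simp
    qed
    then have "(\<Prod>i\<in>N. c i + (\<Sum>k\<in>A. a i k)) =
        (\<Sum>f\<in>Ph. \<Prod>i\<in>N. if \<forall>k. f i = Some k \<longrightarrow> k \<in> A then b i (f i) else 0)"
      unfolding Ph_def using assms by (simp only: prod_sum_PiE Opt_def finite_insert finite_imageI)
    also have "\<dots> = (\<Sum>f\<in>Ph. if \<forall>k. Some k \<in> f ` N \<longrightarrow> k \<in> A then \<Prod>i\<in>N. b i (f i) else 0)"
    proof (intro sum.cong refl)
      fix f
      show "(\<Prod>i\<in>N. if \<forall>k. f i = Some k \<longrightarrow> k \<in> A then b i (f i) else 0) =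
          (if \<forall>k. Some k \<in> f ` N \<longrightarrow> k \<in> A then \<Prod>i\<in>N. b i (f i) else 0)"
      proof (cases "\<forall>k. Some k \<in> f ` N \<longrightarrow> k \<in> A")
        case True
        then have "(if \<forall>k. f i = Some k \<longrightarrow> k \<in> A then b i (f i) else 0) = b i (f i)" if "i \<in> N" for i
          using that by (metis image_eqI)
        with True show ?thesis by simp
      next
        case False
        then obtain i where "i \<in> N" "\<not> (\<forall>k. f i = Some k \<longrightarrow> k \<in> A)"
          by (metis imageE)
        then have "(\<Prod>i\<in>N. if \<forall>k. f i = Some k \<longrightarrow> k \<in> A then b i (f i) else 0) = 0"
          using assms by (intro prod_zero) auto
        then show ?thesis unfolding if_not_P[OF False] .
      qed
    qed
    finally show ?thesis .
  qed
  \<comment> \<open>Inclusion-exclusion over the sets between \<open>M\<close> and \<open>N\<close>,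
    obtained by expanding a product with factors \<open>1 + 0\<close> on \<open>M\<close> and
    \<open>1 - 1\<close> off it.\<close>
  have alt: "(\<Sum>A\<in>Pow N. if M \<subseteq> A then (- 1) ^ card (N - A) else 0) = (if M = N then 1 else 0 :: real)"
    if "M \<subseteq> N" for M
  proof -
    have "(\<Sum>A\<in>Pow N. if M \<subseteq> A then (- 1) ^ card (N - A) else 0) =
        (\<Sum>A\<in>Pow N. (\<Prod>k\<in>A. 1) * (\<Prod>k\<in>N - A. if k \<in> M then 0 else - 1 :: real))"
    proof (intro sum.cong refl)
      fix A assume A: "A \<in> Pow N"
      show "(if M \<subseteq> A then (- 1) ^ card (N - A) else 0) =
          (\<Prod>k\<in>A. 1) * (\<Prod>k\<in>N - A. if k \<in> M then 0 else - 1 :: real)"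
      proof (cases "M \<subseteq> A")
        case True
        then have "(\<Prod>k\<in>N - A. if k \<in> M then 0 else - 1 :: real) = (\<Prod>k\<in>N - A. - 1)"
          by (intro prod.cong) auto
        with True show ?thesis by simp
      next
        case False
        then have "(\<Prod>k\<in>N - A. if k \<in> M then 0 else - 1 :: real) = 0"
          using that assms by (intro prod_zero) auto
        with False show ?thesis by simp
      qed
    qed
    also have "\<dots> = (\<Prod>k\<in>N. 1 + (if k \<in> M then 0 else - 1))"
      using prod_add[OF assms, of "\<lambda>_. 1" "\<lambda>k. if k \<in> M then 0 else - 1 :: real"] by simp
    also have "\<dots> = (if M = N then 1 else 0)"
    proof (cases "M = N")
      case False
      then show ?thesis using that assms by (auto intro!: prod_zero)
    qed simp
    finally show ?thesis .
  qed
  have "(\<Sum>A\<in>Pow N. (- 1) ^ card (N - A) * (\<Prod>i\<in>N. c i + (\<Sum>k\<in>A. a i k))) =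
      (\<Sum>A\<in>Pow N. \<Sum>f\<in>Ph. (\<Prod>i\<in>N. b i (f i)) *
        (if {k. Some k \<in> f ` N} \<subseteq> A then (- 1) ^ card (N - A) else 0))"
  proof (intro sum.cong refl)
    fix A assume A: "A \<in> Pow N"
    have "(\<forall>k. Some k \<in> f ` N \<longrightarrow> k \<in> A) \<longleftrightarrow> {k. Some k \<in> f ` N} \<subseteq> A" for f by auto
    then show "(- 1) ^ card (N - A) * (\<Prod>i\<in>N. c i + (\<Sum>k\<in>A. a i k)) =
        (\<Sum>f\<in>Ph. (\<Prod>i\<in>N. b i (f i)) *
          (if {k. Some k \<in> f ` N} \<subseteq> A then (- 1) ^ card (N - A) else 0))"
      by (simp only: expand[OF A] sum_distrib_left) (auto intro!: sum.cong)
  qed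
  also have "\<dots> = (\<Sum>f\<in>Ph. (\<Prod>i\<in>N. b i (f i)) *
        (\<Sum>A\<in>Pow N. if {k. Some k \<in> f ` N} \<subseteq> A then (- 1) ^ card (N - A) else 0))"
    by (subst sum.swap) (simp add: sum_distrib_left)
  also have "\<dots> = (\<Sum>f\<in>Ph. if {k. Some k \<in> f ` N} = N then \<Prod>i\<in>N. b i (f i) else 0)"
  proof (intro sum.cong refl)
    fix f assume "f \<in> Ph"
    then have "{k. Some k \<in> f ` N} \<subseteq> N" by (auto simp: Ph_def Opt_def PiE_def Pi_def)
    then show "(\<Prod>i\<in>N. b i (f i)) *
        (\<Sum>A\<in>Pow N. if {k. Some k \<in> f ` N} \<subseteq> A then (- 1) ^ card (N - A) else 0) =
        (if {k. Some k \<in> f ` N} = N then \<Prod>i\<in>N. b i (f i) else 0)"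
      by (simp only: alt) simp
  qed
  also have "\<dots> = (\<Sum>f\<in>{f \<in> Ph. {k. Some k \<in> f ` N} = N}. \<Prod>i\<in>N. b i (f i))"
    using fin by (simp add: sum.inter_filter)
  also have "\<dots> = (\<Sum>p | p permutes N. \<Prod>i\<in>N. a i (p i))"
  proof (rule sum.reindex_bij_witness[where i = "\<lambda>p. restrict (Some \<circ> p) N"
        and j = "\<lambda>f k. if k \<in> N then the (f k) else k"])
    fix f assume "f \<in> {f \<in> Ph. {k. Some k \<in> f ` N} = N}"
    then have f: "f \<in> Ph" "{k. Some k \<in> f ` N} = N" by auto
    \<comment> \<open>By counting, a choice function that uses every column uses each exactly once
      and never takes \<open>None\<close>.\<close>
    have "Some ` N \<subseteq> f ` N" using f(2) by auto
    moreover have "card (f ` N) \<le> card (Some ` N)"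
      using assms by (simp add: card_image card_image_le)
    ultimately have im: "f ` N = Some ` N" using assms by (metis card_seteq finite_imageI)
    then have "card (f ` N) = card N" by (simp add: card_image)
    then have inj: "inj_on f N" using assms by (simp add: inj_on_iff_eq_card)
    let ?p = "\<lambda>k. if k \<in> N then the (f k) else k"
    have fp: "f k = Some (?p k)" if "k \<in> N" for k
    proof -
      have "f k \<in> Some ` N" using im that by blast
      then show ?thesis using that by auto
    qed
    have "bij_betw ?p N N"
    proof (intro bij_betw_imageI)
      show "inj_on ?p N" using inj fp by (metis (no_types, lifting) inj_on_def)
      show "?p ` N = N"
      proof -
        have "Some ` (?p ` N) = f ` N" using fp by (auto simp: image_iff)
        then show ?thesis using im by (simp add: inj_image_eq_iff)
      qed
    qed
    then show "?p \<in> {p. p permutes N}" by (auto intro!: bij_imp_permutes)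
    show "restrict (Some \<circ> ?p) N = f"
    proof
      fix k show "restrict (Some \<circ> ?p) N k = f k"
        using fp[of k] f(1) by (cases "k \<in> N") (auto simp: Ph_def PiE_def extensional_def)
    qed
    show "(\<Prod>i\<in>N. a i (?p i)) = (\<Prod>i\<in>N. b i (f i))"
    proof (intro prod.cong refl)
      fix i assume "i \<in> N"
      have "b i (Some (?p i)) = a i (?p i)" by (simp add: b_def)
      with arg_cong[OF fp[OF \<open>i \<in> N\<close>], of "b i"] show "a i (?p i) = b i (f i)"
        by (rule trans[symmetric])
    qed
  next
    fix p assume "p \<in> {p. p permutes N}"
    then have p: "p permutes N" by simp
    show "(\<lambda>k. if k \<in> N then the (restrict (Some \<circ> p) N k) else k) = p"
      using p by (auto simp: fun_eq_iff permutes_def)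
    have "{k. Some k \<in> restrict (Some \<circ> p) N ` N} = p ` N" by (auto simp: image_iff)
    then show "restrict (Some \<circ> p) N \<in> {f \<in> Ph. {k. Some k \<in> f ` N} = N}"
      using permutes_image[OF p] permutes_in_image[OF p] by (auto simp: Ph_def Opt_def)
  qed
  also have "\<dots> = permanent N a"
    using permanent_transpose[of N a] by (simp add: permanent_def)
  finally show ?thesis .
qed

text \<open>If the permanent vanished then so would the sum of the squares of all permanents \<open>T j\<close> of
  \<open>b i (j k)\<close>, which determine the permanent of the constant columns \<open>\<Sum>v\<in>V. b i v * y v\<close>.\<close>

lemma permanent_gram_nonzero:
  fixes b :: "'i \<Rightarrow> 'v \<Rightarrow> real"
  assumes "finite N" "finite V" and y: "\<And>i. i \<in> N \<Longrightarrow> (\<Sum>v\<in>V. b i v * y v) \<noteq> 0"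
  shows "permanent N (\<lambda>i k. \<Sum>v\<in>V. b i v * b k v) \<noteq> 0"
proof
  define J where "J = PiE N (\<lambda>_. V)"
  define T where "T j = permanent N (\<lambda>i k. b i (j k))" for j
  have finJ: "finite J" using assms by (auto simp: J_def intro!: finite_PiE)
  \<comment> \<open>Multilinearity in the columns: choosing one index \<open>j k\<close> per column
    splits the permanent into multiples of the \<open>T j\<close>.\<close>
  have expand: "(\<Sum>j\<in>J. T j * (\<Prod>k\<in>N. w k (j k))) =
      permanent N (\<lambda>i k. \<Sum>v\<in>V. b i v * w k v)" for w
  proof -
    have "(\<Sum>j\<in>J. T j * (\<Prod>k\<in>N. w k (j k))) =
        (\<Sum>p | p permutes N. \<Sum>j\<in>J. \<Prod>k\<in>N. b (p k) (j k) * w k (j k))"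
      unfolding T_def permanent_def sum_distrib_right
      by (subst sum.swap) (simp add: prod.distrib)
    also have "\<dots> = permanent N (\<lambda>i k. \<Sum>v\<in>V. b i v * w k v)"
      unfolding permanent_def J_def using assms by (simp add: prod_sum_PiE)
    finally show ?thesis .
  qed
  assume zero: "permanent N (\<lambda>i k. \<Sum>v\<in>V. b i v * b k v) = 0"
  \<comment> \<open>One factor \<open>T j\<close> is written out over permutations \<open>q\<close>;
    each \<open>q\<close> then contributes the Gram permanent with permuted columns.\<close>
  have "(\<Sum>j\<in>J. T j * T j) = (\<Sum>q | q permutes N. \<Sum>j\<in>J. T j * (\<Prod>k\<in>N. b (q k) (j k)))"
    unfolding T_def[of "_"] permanent_def sum_distrib_left by (subst sum.swap) simp
  also have "\<dots> = 0"
  proof (rule sum.neutral, rule ballI)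
    fix q assume "q \<in> {q. q permutes N}"
    then have q: "q permutes N" by simp
    show "(\<Sum>j\<in>J. T j * (\<Prod>k\<in>N. b (q k) (j k))) = 0"
      using permanent_permute_columns[OF q, of "\<lambda>i k. \<Sum>v\<in>V. b i v * b k v"] zero
      by (simp add: expand[of "\<lambda>k. b (q k)"])
  qed
  finally have "\<forall>j\<in>J. T j = 0" using finJ by (simp add: sum_nonneg_eq_0_iff)
  then have "permanent N (\<lambda>i k. \<Sum>v\<in>V. b i v * y v) = 0"
    using expand[of "\<lambda>_. y"] by simp
  \<comment> \<open>With constant columns all permutations contribute the same product, which is
    nonzero by the choice of \<open>y\<close>.\<close>
  moreover have "permanent N (\<lambda>i k. \<Sum>v\<in>V. b i v * y v) =
      (\<Sum>p | p permutes N. \<Prod>i\<in>N. \<Sum>v\<in>V. b i v * y v)"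
    unfolding permanent_def
    by (intro sum.cong refl) (auto intro!: prod.reindex_bij_betw permutes_imp_bij)
  moreover have "card {p. p permutes N} \<noteq> 0" using assms by (simp add: card_permutations)
  ultimately show False using assms y by auto
qed

section \<open>Selecting the switchable edges\<close>

definition incidence :: "('e \<Rightarrow> 'v) \<Rightarrow> ('e \<Rightarrow> 'v) \<Rightarrow> 'e \<Rightarrow> 'v \<Rightarrow> real" where
  "incidence h t e v = (if v = h e then 1 else 0) - (if v = t e then 1 else 0)"

lemma sum_incidence:
  assumes "finite V" "h e \<in> V" "t e \<in> V"
  shows "(\<Sum>v\<in>V. incidence h t e v * y v) = y (h e) - y (t e)"
proof -
  have "(\<Sum>v\<in>V. incidence h t e v * y v) =
      (\<Sum>v\<in>V. if v = h e then y v else 0) - (\<Sum>v\<in>V. if v = t e then y v else 0)"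
    unfolding sum_subtractf[symmetric] by (intro sum.cong) (auto simp: incidence_def)
  then show ?thesis using assms by simp
qed

text \<open>Only the homogeneous part of the right degree is kept, by comparing coefficients of \<open>s\<close> in the
  expansion at \<open>s * y\<close>.\<close>

lemma tension_expansion_homogeneous:
  assumes "finite V" "finite E" "finite I" and ends: "\<And>e. e \<in> E \<union> I \<Longrightarrow> h e \<in> V \<and> t e \<in> V"
    and cut: "\<And>U. U \<noteq> {} \<Longrightarrow> U \<subset> V \<Longrightarrow>
      card {i \<in> I. crosses h t U i} \<le> card {e \<in> E. crosses h t U e}"
    and conn: "cut_connected V h t (E \<union> I)"
  shows "\<exists>c.
    (\<forall>F. c F \<noteq> 0 \<longrightarrow> F \<subseteq> E \<and> card F = card I \<and> cut_connected V h t ((E - F) \<union> I)) \<and>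
    (\<forall>y\<in>potentials V h t {}. tension_prod h t I y = (\<Sum>F\<in>Pow E. c F * tension_prod h t F y))"
proof -
  have deg: "deg_less U (cut_bound V h t I E U) (tension_prod h t I) y"
    if "saturated V h t {} U" for U y
  proof (rule deg_less_mono[OF deg_less_tension_prod[OF assms(3)]])
    have U: "U \<noteq> {}" "U \<subseteq> V" using that by (auto simp: saturated_def)
    show "Suc (card {i \<in> I. crosses h t U i}) \<le> cut_bound V h t I E U"
    proof (cases "U = V")
      case True
      then have "{i \<in> I. crosses h t U i} = {}" using ends by (auto simp: crosses_def)
      then have "card {i \<in> I. crosses h t U i} \<le> card {e \<in> E. crosses h t U e}"
        by (simp only: card.empty le0)
      with True show ?thesis by (simp add: cut_bound_def)
    next
      case False
      then have psub: "U \<subset> V" using U by auto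
      show ?thesis
      \<comment> \<open>If an edge of \<open>I\<close> crosses \<open>U\<close>, the extra 1 in
        \<open>cut_bound\<close> pays for \<open>Suc\<close>. If none does, the degree is 0 and
        connectivity provides a crossing edge of \<open>E\<close>.\<close>
      proof (cases "\<exists>i\<in>I. crosses h t U i")
        case True
        then show ?thesis using cut[OF U(1) psub] by (simp add: cut_bound_def)
      next
        case noI: False
        then obtain e where "e \<in> E" "crosses h t U e"
          using conn U(1) psub unfolding cut_connected_def by blast
        then have "card {e \<in> E. crosses h t U e} > 0" using assms(2) by (auto simp: card_gt_0_iff)
        moreover have "{i \<in> I. crosses h t U i} = {}" using noI by auto
        ultimately have "Suc (card {i \<in> I. crosses h t U i}) \<le> card {e \<in> E. crosses h t U e}"
          by (simp only: card.empty Suc_le_eq)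
        then show ?thesis using psub noI by (auto simp: cut_bound_def)
      qed
    qed
  qed
  have "\<exists>c. (\<forall>F. c F \<noteq> 0 \<longrightarrow> F \<subseteq> E \<and> cut_connected V h t ({} \<union> (E - F) \<union> I)) \<and>
       (\<forall>y\<in>potentials V h t {}. tension_prod h t I y = (\<Sum>F\<in>Pow E. c F * tension_prod h t F y))"
    by (rule tension_expansion) (use assms(1,2) ends deg polyfun_tension_prod in auto)
  then obtain c where c: "\<forall>F. c F \<noteq> 0 \<longrightarrow> F \<subseteq> E \<and> cut_connected V h t ({} \<union> (E - F) \<union> I)"
    "\<forall>y\<in>potentials V h t {}. tension_prod h t I y = (\<Sum>F\<in>Pow E. c F * tension_prod h t F y)"
    by (elim exE conjE)
  note c = c[rule_format, unfolded Un_empty_left]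
  have scale: "tension_prod h t F (\<lambda>v. s * y v) = s ^ card F * tension_prod h t F y" for F s y
    by (simp add: tension_prod_def right_diff_distrib[symmetric] prod.distrib)
  show ?thesis
  proof (intro exI[of _ "\<lambda>F. if card F = card I then c F else 0"] conjI allI ballI impI)
    show "F \<subseteq> E" "card F = card I" "cut_connected V h t ((E - F) \<union> I)"
      if "(if card F = card I then c F else 0) \<noteq> 0" for F
      using that c(1)[of F] by (auto split: if_splits)
    fix y assume y: "y \<in> potentials V h t {}"
    define p where "p = (\<Sum>F\<in>Pow E. monom (c F * tension_prod h t F y) (card F))"
    have "poly p s = poly (monom (tension_prod h t I y) (card I)) s" for s
    proof -
      have "(\<lambda>v. s * y v) \<in> potentials V h t {}" using y by (simp add: potentials_def)
      from c(2)[OF this] show ?thesis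
        by (simp add: p_def poly_sum poly_monom scale algebra_simps)
    qed
    then have "p = monom (tension_prod h t I y) (card I)"
      by (simp add: poly_eq_poly_eq_iff[symmetric] fun_eq_iff)
    then have "coeff p (card I) = tension_prod h t I y" by simp
    then show "tension_prod h t I y =
        (\<Sum>F\<in>Pow E. (if card F = card I then c F else 0) * tension_prod h t F y)"
      unfolding p_def coeff_sum coeff_monom
      by (auto intro!: sum.cong elim!: subst)
  qed
qed

text \<open>The alternating sum over the incidence vectors of \<open>I\<close> turns the expansion of the tension product
  of \<open>I\<close> into a linear relation between permanents whose left-hand side is the permanent of a Gram
  matrix, so some permanent on the right-hand side does not vanish.\<close>

lemma nonvanishing_selection:
  assumes "finite V" "finite E" "finite I" and ends: "\<And>e. e \<in> E \<union> I \<Longrightarrow> h e \<in> V \<and> t e \<in> V"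
    and loop: "\<And>i. i \<in> I \<Longrightarrow> h i \<noteq> t i"
    and cut: "\<And>U. U \<noteq> {} \<Longrightarrow> U \<subset> V \<Longrightarrow>
      card {i \<in> I. crosses h t U i} \<le> card {e \<in> E. crosses h t U e}"
    and conn: "cut_connected V h t (E \<union> I)"
  obtains F b where "F \<subseteq> E" "cut_connected V h t ((E - F) \<union> I)" "bij_betw b I F"
    "permanent I (\<lambda>i k. incidence h t (b k) (h i) - incidence h t (b k) (t i)) \<noteq> 0"
proof -
  have "\<exists>c.
    (\<forall>F. c F \<noteq> 0 \<longrightarrow> F \<subseteq> E \<and> card F = card I \<and> cut_connected V h t ((E - F) \<union> I)) \<and>
    (\<forall>y\<in>potentials V h t {}. tension_prod h t I y = (\<Sum>F\<in>Pow E. c F * tension_prod h t F y))"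
    by (rule tension_expansion_homogeneous[OF assms(1-4) cut conn])
  then obtain c where c:
    "\<forall>F. c F \<noteq> 0 \<longrightarrow> F \<subseteq> E \<and> card F = card I \<and> cut_connected V h t ((E - F) \<union> I)"
    "\<forall>y\<in>potentials V h t {}. tension_prod h t I y = (\<Sum>F\<in>Pow E. c F * tension_prod h t F y)"
    by (elim exE conjE)
  note c = c[rule_format]
  define S where "S g = (\<Sum>A\<in>Pow I. (- 1) ^ card (I - A) * g (\<lambda>v. \<Sum>k\<in>A. incidence h t k v))"
    for g :: "('a \<Rightarrow> real) \<Rightarrow> real"
  \<comment> \<open>Both sides are the inner product of the incidence vectors of \<open>i\<close>
    and \<open>k\<close>.\<close>
  have sym: "incidence h t i (h k) - incidence h t i (t k) =
      incidence h t k (h i) - incidence h t k (t i)" for i k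
    by (auto simp: incidence_def)
  have S_prod: "S (tension_prod h t F) =
      permanent I (\<lambda>i k. incidence h t (b k) (h i) - incidence h t (b k) (t i))"
    if b: "bij_betw b I F" for F b
  proof -
    have "tension_prod h t F (\<lambda>v. \<Sum>k\<in>A. incidence h t k v) =
        (\<Prod>i\<in>I. 0 + (\<Sum>k\<in>A. incidence h t k (h (b i)) - incidence h t k (t (b i))))" for A
      unfolding tension_prod_def prod.reindex_bij_betw[OF b, symmetric]
      by (simp add: sum_subtractf)
    then have "S (tension_prod h t F) =
        permanent I (\<lambda>i k. incidence h t k (h (b i)) - incidence h t k (t (b i)))"
      unfolding S_def by (simp only: alternating_sum_prod[OF assms(3)])
    also have "\<dots> = permanent I (\<lambda>i k. incidence h t i (h (b k)) - incidence h t i (t (b k)))"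
      by (rule permanent_transpose[symmetric])
    finally show ?thesis by (simp add: sym)
  qed
  \<comment> \<open>An injective labelling of \<open>V\<close> has a nonzero difference along each
    edge of \<open>I\<close>, as \<open>permanent_gram_nonzero\<close> requires of its vector
    \<open>y\<close>.\<close>
  obtain f :: "'a \<Rightarrow> nat" where f: "inj_on f V" using finite_imp_inj_to_nat_seg[OF assms(1)] by (elim exE conjE)
  have "permanent I (\<lambda>i k. \<Sum>v\<in>V. incidence h t i v * incidence h t k v) \<noteq> 0"
  proof (rule permanent_gram_nonzero[OF assms(3,1)])
    fix i assume "i \<in> I"
    then have "h i \<in> V" "t i \<in> V" using ends[of i] by blast+
    then have "f (h i) \<noteq> f (t i)" using loop[OF \<open>i \<in> I\<close>] f by (metis inj_onD)
    then show "(\<Sum>v\<in>V. incidence h t i v * real (f v)) \<noteq> 0"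
      using sum_incidence[of V h i t "\<lambda>v. real (f v)"] assms(1) \<open>h i \<in> V\<close> \<open>t i \<in> V\<close> by simp
  qed
  moreover have "permanent I (\<lambda>i k. \<Sum>v\<in>V. incidence h t i v * incidence h t k v) =
      permanent I (\<lambda>i k. incidence h t k (h i) - incidence h t k (t i))"
    unfolding permanent_def
  proof (intro sum.cong prod.cong refl)
    fix p i assume "p \<in> {p. p permutes I}" "i \<in> I"
    then have "p i \<in> E \<union> I" by (auto simp: permutes_in_image)
    from sum_incidence[OF assms(1), of h "p i" t "incidence h t i"] ends[OF this]
    show "(\<Sum>v\<in>V. incidence h t (p i) v * incidence h t i v) =
        incidence h t i (h (p i)) - incidence h t i (t (p i))" by blast
  qed
  ultimately have nz: "S (tension_prod h t I) \<noteq> 0"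
    using S_prod[OF bij_betw_id[of I]] by (simp add: id_def)
  have "S (tension_prod h t I) = (\<Sum>F\<in>Pow E. c F * S (tension_prod h t F))"
  proof -
    have "(\<lambda>v. \<Sum>k\<in>A. incidence h t k v) \<in> potentials V h t {}" if "A \<in> Pow I" for A
      using that ends by (force simp: potentials_def incidence_def intro!: sum.neutral)
    then have "S (tension_prod h t I) = (\<Sum>A\<in>Pow I. (- 1) ^ card (I - A) *
        (\<Sum>F\<in>Pow E. c F * tension_prod h t F (\<lambda>v. \<Sum>k\<in>A. incidence h t k v)))"
      unfolding S_def by (intro sum.cong refl) (simp add: c(2))
    also have "\<dots> = (\<Sum>F\<in>Pow E. c F * S (tension_prod h t F))"
      unfolding S_def sum_distrib_left by (subst sum.swap) (simp add: mult.left_commute)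
    finally show ?thesis .
  qed
  with nz have "\<exists>F\<in>Pow E. c F * S (tension_prod h t F) \<noteq> 0"
    by (intro ccontr[where P = "\<exists>F\<in>Pow E. c F * S (tension_prod h t F) \<noteq> 0"]) (simp add: sum.neutral)
  then obtain F where F: "c F * S (tension_prod h t F) \<noteq> 0" by blast
  then have cF: "c F \<noteq> 0" by auto
  have "finite F" using c(1)[OF cF] assms(2) finite_subset by auto
  then obtain b where b: "bij_betw b I F"
    using c(1)[OF cF] assms(3) finite_same_card_bij by metis
  show thesis
  proof (rule that)
    show "F \<subseteq> E" "cut_connected V h t ((E - F) \<union> I)" using c(1)[OF cF] by blast+
    show "permanent I (\<lambda>i k. incidence h t (b k) (h i) - incidence h t (b k) (t i)) \<noteq> 0"
      using F S_prod[OF b] by simp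
  qed (rule b)
qed

text \<open>If each \<open>A\<close> made some entry vanish, every product in the alternating sum
  for the permanent would be 0. In the application \<open>A\<close> indexes the switched edges and
  \<open>c\<close> holds the discrepancies before switching.\<close>

lemma avoid_zeros:
  assumes "finite N" "permanent N a \<noteq> 0"
  obtains A where "A \<subseteq> N" "\<And>i. i \<in> N \<Longrightarrow> c i + (\<Sum>k\<in>A. a i k) \<noteq> 0"
proof -
  have "\<exists>A\<in>Pow N. (\<Prod>i\<in>N. c i + (\<Sum>k\<in>A. a i k)) \<noteq> 0"
  proof (rule ccontr)
    assume "\<not> ?thesis"
    then have "(\<Sum>A\<in>Pow N. (- 1) ^ card (N - A) * (\<Prod>i\<in>N. c i + (\<Sum>k\<in>A. a i k))) = 0"
      by (intro sum.neutral) auto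
    with assms show False by (simp only: alternating_sum_prod[OF assms(1)])
  qed
  with assms(1) that show thesis by (auto simp: prod_zero_iff)
qed

section \<open>Finite graphs\<close>

text \<open>Edges of \<open>E\<close> that do not lie inside \<open>V\<close> are ignored, so a
  vertex is deleted by shrinking \<open>V\<close> alone.\<close>

definition set_connected :: "'a set \<Rightarrow> 'a set set \<Rightarrow> bool" where
  "set_connected V E \<longleftrightarrow> (\<forall>U. U \<noteq> {} \<longrightarrow> U \<subset> V \<longrightarrow> (\<exists>u\<in>U. \<exists>v\<in>V - U. {u, v} \<in> E))"

text \<open>In a smallest component \<open>C\<close> that the deletion of a vertex \<open>c\<close> can split off, no vertex is a
  cut vertex; as all neighbours of \<open>C\<close> lie in \<open>C \<union> {c}\<close>, a vertex of \<open>C\<close> of minimum or of maximum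
  degree will do.\<close>

lemma noncut_local_extremum:
  fixes d :: "'a \<Rightarrow> nat"
  assumes "finite V" "V \<noteq> {}" "set_connected V E"
  obtains z where "z \<in> V" "set_connected (V - {z}) E"
    "(\<forall>u\<in>V. {u, z} \<in> E \<longrightarrow> d u \<le> d z) \<or> (\<forall>u\<in>V. {u, z} \<in> E \<longrightarrow> d z \<le> d u)"
proof (cases "\<forall>z\<in>V. set_connected (V - {z}) E")
  case True
  obtain z where "z \<in> V" "\<forall>u\<in>V. d z \<le> d u"
    using ex_has_least_nat[of "\<lambda>v. v \<in> V" _ d] assms(2) by blast
  then show thesis using that True by blast
next
  case False
  \<comment> \<open>A pair consists of a cut vertex and a nonempty union of some, but not all,
    components left by its deletion.\<close>
  define split where "split p \<longleftrightarrow> fst p \<in> V \<and> snd p \<noteq> {} \<and> snd p \<subset> V - {fst p} \<and>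
    (\<forall>u\<in>snd p. \<forall>v\<in>V - {fst p} - snd p. {u, v} \<notin> E)" for p :: "'a \<times> 'a set"
  have "\<exists>p. split p"
    using False unfolding set_connected_def split_def by (metis fst_conv snd_conv)
  then obtain p where p: "split p" "\<And>q. split q \<Longrightarrow> card (snd p) \<le> card (snd q)"
    using ex_has_least_nat[of split _ "\<lambda>p. card (snd p)"] by blast
  define c where "c = fst p"
  define C where "C = snd p"
  have c: "c \<in> V" "C \<noteq> {}" "C \<subset> V - {c}" "\<And>u v. u \<in> C \<Longrightarrow> v \<in> V - {c} - C \<Longrightarrow> {u, v} \<notin> E"
    using p(1) by (auto simp: split_def c_def C_def)
  have finC: "finite C" using c(3) assms(1) finite_subset by blast
  have noncut: "set_connected (V - {x}) E" if x: "x \<in> C" for x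
  proof (rule ccontr)
    assume "\<not> ?thesis"
    then obtain U where U: "U \<noteq> {}" "U \<subset> V - {x}" "\<forall>u\<in>U. \<forall>v\<in>V - {x} - U. {u, v} \<notin> E"
      unfolding set_connected_def by blast
    \<comment> \<open>Both sides of the separation are closed, so the one without \<open>c\<close>
      may be taken.\<close>
    obtain D where D: "D \<noteq> {}" "D \<subset> V - {x}" "\<forall>u\<in>D. \<forall>v\<in>V - {x} - D. {u, v} \<notin> E" "c \<notin> D"
    proof (cases "c \<in> U")
      case False
      then show ?thesis using that U by blast
    next
      case True
      have "{u, v} \<notin> E" if "u \<in> V - {x} - U" "v \<in> V - {x} - (V - {x} - U)" for u v
        using U(2,3) that by (metis Diff_iff insert_commute)
      with True U that[of "V - {x} - U"] show ?thesis by blast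
    qed
    have "D \<subseteq> C"
    proof (rule ccontr)
      assume "\<not> D \<subseteq> C"
      \<comment> \<open>No edge can leave \<open>D - C\<close>: edges between \<open>C\<close> and
        its outside end in \<open>c\<close>, which is not in \<open>D\<close>, and edges leaving
        \<open>D\<close> end in \<open>x\<close>, which is in \<open>C\<close>. This contradicts the
        connectivity of the whole graph.\<close>
      then have "D - C \<noteq> {}" "D - C \<subset> V" using D(2) by blast+
      then obtain u v where uv: "u \<in> D - C" "v \<in> V - (D - C)" "{u, v} \<in> E"
        using assms(3) unfolding set_connected_def by meson
      have "v \<notin> C"
        using c(4)[of v u] uv D by (metis Diff_iff insert_commute insertE empty_iff subsetD psubsetE)
      then have "v \<in> V - {x} - D" using uv x by auto
      with D(3) uv show False by blast
    qed
    moreover have "x \<notin> D" using D(2) by blast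
    ultimately have "D \<subset> C" using x by blast
    then have "card D < card C" using finC psubset_card_mono by blast
    moreover have "split (x, D)" using D x c(3) by (auto simp: split_def)
    ultimately show False using p(2)[of "(x, D)"] by (simp add: C_def)
  qed
  have nbr: "u \<in> C \<or> u = c" if "x \<in> C" "u \<in> V" "{u, x} \<in> E" for u x
    using c(4)[of x u] that by (metis Diff_iff insert_commute singletonD)
  obtain m where m: "m \<in> C" "\<forall>u\<in>C. d m \<le> d u"
    using ex_has_least_nat[of "\<lambda>v. v \<in> C" _ d] c(2) by blast
  obtain M where M: "M \<in> C" "\<forall>u\<in>C. d u \<le> d M"
    using ex_has_greatest_nat[of "\<lambda>v. v \<in> C" _ d "Suc (Max (d ` C))"] c(2) finC
    by (metis (no_types, lifting) Max_ge all_not_in_conv finite_imageI image_eqI le_imp_less_Suc less_imp_le_nat)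
  show thesis
  \<comment> \<open>Only \<open>c\<close> can compete from outside \<open>C\<close>: if its degree
    is not below the minimum then \<open>m\<close> works, otherwise it is below the maximum as well
    and \<open>M\<close> works.\<close>
  proof (cases "d m \<le> d c")
    case True
    then have "\<forall>u\<in>V. {u, m} \<in> E \<longrightarrow> d m \<le> d u" using nbr m by blast
    then show ?thesis using that[of m] m noncut c(3) by blast
  next
    case False
    then have "d c \<le> d M" using m M by fastforce
    then have "\<forall>u\<in>V. {u, M} \<in> E \<longrightarrow> d u \<le> d M" using nbr M by blast
    then show ?thesis using that[of M] M noncut c(3) by blast
  qed
qed

section \<open>Parity and joins\<close>

lemma odd_card_sym_diff:
  assumes "finite X" "finite Y"
  shows "odd (card (sym_diff X Y)) \<longleftrightarrow> odd (card X) \<noteq> odd (card Y)"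
proof -
  have "card X = card (X - Y) + card (X \<inter> Y)" "card Y = card (Y - X) + card (X \<inter> Y)"
    using assms card_Int_Diff[of X Y] card_Int_Diff[of Y X] by (auto simp: Int_commute)
  moreover have "card (sym_diff X Y) = card (X - Y) + card (Y - X)"
    using assms by (intro card_Un_disjoint) auto
  ultimately show ?thesis by auto
qed

text \<open>Existence of T-joins. The sets \<open>T\<close> that admit one are closed under
  symmetric difference and include the end pair of each edge, hence by connectivity every pair of
  vertices, and pairs generate all even sets.\<close>

lemma parity_join:
  assumes "finite A" "finite V" "cut_connected V h t A"
    and ends: "\<And>e. e \<in> A \<Longrightarrow> h e \<in> V \<and> t e \<in> V \<and> h e \<noteq> t e"
    and "T \<subseteq> V" "even (card T)"
  shows "\<exists>J\<subseteq>A. \<forall>v\<in>V. odd (card {e \<in> J. v = h e \<or> v = t e}) \<longleftrightarrow> v \<in> T"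
proof -
  define good where
    "good T \<longleftrightarrow> (\<exists>J\<subseteq>A. \<forall>v\<in>V. odd (card {e \<in> J. v = h e \<or> v = t e}) \<longleftrightarrow> v \<in> T)" for T
  have good_diff: "good (sym_diff T1 T2)" if g: "good T1" "good T2" for T1 T2
  proof -
    obtain J1 J2 where J: "J1 \<subseteq> A" "J2 \<subseteq> A"
      "\<forall>v\<in>V. odd (card {e \<in> J1. v = h e \<or> v = t e}) \<longleftrightarrow> v \<in> T1"
      "\<forall>v\<in>V. odd (card {e \<in> J2. v = h e \<or> v = t e}) \<longleftrightarrow> v \<in> T2"
      using g unfolding good_def by (elim exE conjE)
    have fin: "finite J1" "finite J2" using J(1,2) assms(1) finite_subset by auto
    have "odd (card {e \<in> sym_diff J1 J2. v = h e \<or> v = t e}) \<longleftrightarrow> v \<in> sym_diff T1 T2" if "v \<in> V" for v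
    proof -
      have "{e \<in> sym_diff J1 J2. v = h e \<or> v = t e} =
          sym_diff {e \<in> J1. v = h e \<or> v = t e} {e \<in> J2. v = h e \<or> v = t e}" by auto
      then show ?thesis using J(3,4) that fin by (auto simp: odd_card_sym_diff)
    qed
    moreover have "sym_diff J1 J2 \<subseteq> A" using J by blast
    ultimately show ?thesis unfolding good_def by blast
  qed
  have good_empty: "good {}" unfolding good_def by (intro exI[of _ "{}"]) simp
  have good_edge: "good {h e, t e}" if e: "e \<in> A" for e
  proof -
    have "{x \<in> {e}. v = h x \<or> v = t x} = (if v \<in> {h e, t e} then {e} else {})" for v by auto
    then show ?thesis using e unfolding good_def by (intro exI[of _ "{e}"]) simp
  qed
  \<comment> \<open>The form \<open>sym_diff {u} {v}\<close> covers \<open>u = v\<close>, where it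
    is empty.\<close>
  have good_pair: "good (sym_diff {u} {v})" if uv: "u \<in> V" "v \<in> V" for u v
  proof -
    define R where "R = {x \<in> V. good (sym_diff {u} {x})}"
    have "R = V"
    proof (rule ccontr)
      assume "R \<noteq> V"
      moreover have "u \<in> R" using uv good_empty by (simp add: R_def)
      ultimately have "R \<noteq> {}" "R \<subset> V" by (auto simp: R_def)
      then obtain e where e: "e \<in> A" "crosses h t R e" using cut_connectedD[OF assms(3)] by blast
      have step: "y \<in> R" if "x \<in> R" "{x, y} = {h e, t e}" "x \<noteq> y" "y \<in> V" for x y
      proof -
        have "good (sym_diff (sym_diff {u} {x}) {x, y})"
          using that good_edge[OF e(1)] by (intro good_diff[of "sym_diff {u} {x}"]) (simp_all add: R_def)
        moreover have "sym_diff (sym_diff {u} {x}) {x, y} = sym_diff {u} {y}" using that(3) by auto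
        ultimately show ?thesis using that(4) by (simp add: R_def)
      qed
      show False
        using e(2) ends[OF e(1)] step[of "h e" "t e"] step[of "t e" "h e"]
        by (auto simp: crosses_def insert_commute)
    qed
    then show ?thesis using uv by (auto simp: R_def)
  qed
  have "good T"
    using assms(5,6)
  proof (induction "card T" arbitrary: T rule: less_induct)
    case less
    have finT: "finite T" using less.prems assms(2) finite_subset by blast
    show ?case
    proof (cases "T = {}")
      case False
      then obtain u where u: "u \<in> T" by blast
      have "T \<noteq> {u}" using less.prems by auto
      then obtain v where v: "v \<in> T" "v \<noteq> u" using u by blast
      define T' where "T' = T - {u, v}"
      have card: "card T = card T' + 2"
        using u v finT card_Diff_subset[of "{u, v}" T] card_mono[of T "{u, v}"]
        by (simp add: T'_def)
      have "good T'" using less.prems card by (intro less.hyps) (auto simp: T'_def)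
      then have "good (sym_diff T' (sym_diff {u} {v}))"
        using good_pair[of u v] u v less.prems by (intro good_diff[of T']) auto
      moreover have "sym_diff T' (sym_diff {u} {v}) = T" using u v by (auto simp: T'_def)
      ultimately show ?thesis by simp
    qed (simp add: good_empty)
  qed
  then show ?thesis unfolding good_def .
qed

section \<open>Incident edges and degree sums\<close>

lemma graph_inE:
  assumes "graph_in Q" "e \<in> edges Q"
  obtains a b where "a \<in> verts Q" "b \<in> verts Q" "a \<noteq> b" "e = {a, b}"
  using assms unfolding graph_in_def by metis

lemma sum_neighbours:
  assumes "graph_in Q"
  shows "(\<Sum>v\<in>neighbours Q u. f {u, v}) = (\<Sum>e | e \<in> edges Q \<and> u \<in> e. f e)"
proof (rule sum.reindex_bij_betw)
  show "bij_betw (\<lambda>v. {u, v}) (neighbours Q u) {e \<in> edges Q. u \<in> e}"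
  proof (rule bij_betwI')
    show "({u, x} = {u, y}) = (x = y)" for x y by (auto simp: doubleton_eq_iff)
    show "{u, x} \<in> {e \<in> edges Q. u \<in> e}" if "x \<in> neighbours Q u" for x
      using that by (simp add: neighbours_def)
    show "\<exists>x\<in>neighbours Q u. e = {u, x}" if "e \<in> {e \<in> edges Q. u \<in> e}" for e
    proof -
      have e: "e \<in> edges Q" "u \<in> e" using that by simp_all
      obtain a b where ab: "e = {a, b}" by (rule graph_inE[OF assms e(1)])
      then have "e = {u, a} \<or> e = {u, b}" using e(2) by auto
      then show ?thesis using e(1) unfolding neighbours_def by blast
    qed
  qed
qed

lemma card_neighbours:
  assumes "graph_in Q"
  shows "card (neighbours Q u) = card {e \<in> edges Q. u \<in> e}"
  using sum_neighbours[OF assms, of "\<lambda>_. 1::nat" u] by simp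

text \<open>Double counting: an edge at \<open>z\<close> has one end left, every other edge two.
  Modulo 2, the degree sum over the remaining vertices is therefore the degree of
  \<open>z\<close>.\<close>

lemma handshake_delete:
  assumes "graph_in Q" "finite (verts Q)" "z \<in> verts Q"
  shows "(\<Sum>u\<in>verts Q - {z}. card (neighbours Q u)) =
      2 * card {e \<in> edges Q. z \<notin> e} + card (neighbours Q z)"
proof -
  have finE: "finite (edges Q)"
    using assms(1,2) by (intro finite_subset[of "edges Q" "Pow (verts Q)"]) (auto simp: graph_in_def)
  have "(\<Sum>u\<in>verts Q - {z}. card (neighbours Q u)) =
      (\<Sum>u\<in>verts Q - {z}. \<Sum>e\<in>edges Q. if u \<in> e then 1 else 0)"
    using finE by (simp add: card_neighbours[OF assms(1)] sum.If_cases Int_def)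
  also have "\<dots> = (\<Sum>e\<in>edges Q. card ((verts Q - {z}) \<inter> e))"
    using assms(2) by (subst sum.swap) (simp add: sum.If_cases)
  also have "\<dots> = (\<Sum>e\<in>edges Q. if z \<in> e then 1 else 2)"
  proof (intro sum.cong refl)
    fix e assume "e \<in> edges Q"
    then obtain a b where e: "a \<in> verts Q" "b \<in> verts Q" "a \<noteq> b" "e = {a, b}"
      by (rule graph_inE[OF assms(1)])
    then have "(verts Q - {z}) \<inter> e = e - {z}" by auto
    then show "card ((verts Q - {z}) \<inter> e) = (if z \<in> e then 1 else 2)" using e by auto
  qed
  also have "\<dots> = card {e \<in> edges Q. z \<in> e} + 2 * card {e \<in> edges Q. z \<notin> e}"
    using finE by (simp add: sum.If_cases Int_def Compl_eq)
  finally show ?thesis by (simp add: card_neighbours[OF assms(1)])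
qed

text \<open>Otherwise \<open>S\<close> could be improved to the symmetric difference of \<open>S\<close> and \<open>U\<close>.\<close>

lemma max_cut_crossing:
  assumes "finite V" "finite E"
  shows "\<exists>S\<subseteq>V. \<forall>U\<subseteq>V. card {e \<in> E. \<not> crosses h t S e \<and> crosses h t U e} \<le>
      card {e \<in> E. crosses h t S e \<and> crosses h t U e}"
proof -
  define cut where "cut S = {e \<in> E. crosses h t S e}" for S
  have "card (cut S) \<le> card E" for S using assms(2) by (auto simp: cut_def intro: card_mono)
  then have "\<exists>S. S \<subseteq> V \<and> (\<forall>S'. S' \<subseteq> V \<longrightarrow> card (cut S') \<le> card (cut S))"
    using ex_has_greatest_nat[of "\<lambda>S. S \<subseteq> V" "{}" "\<lambda>S. card (cut S)" "Suc (card E)"]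
    by (auto simp: less_Suc_eq_le)
  then obtain S where S: "S \<subseteq> V" "\<And>S'. S' \<subseteq> V \<Longrightarrow> card (cut S') \<le> card (cut S)" by auto
  have "card {e \<in> E. \<not> crosses h t S e \<and> crosses h t U e} \<le>
      card {e \<in> E. crosses h t S e \<and> crosses h t U e}" if U: "U \<subseteq> V" for U
  proof -
    define X where "X = {e \<in> E. crosses h t S e \<and> crosses h t U e}"
    define Y where "Y = {e \<in> E. \<not> crosses h t S e \<and> crosses h t U e}"
    define Z where "Z = {e \<in> E. crosses h t S e \<and> \<not> crosses h t U e}"
    have "cut (sym_diff S U) = Y \<union> Z" "cut S = X \<union> Z" "Y \<inter> Z = {}" "X \<inter> Z = {}"
      by (auto simp: cut_def X_def Y_def Z_def crosses_def)
    moreover have "finite X" "finite Y" "finite Z" using assms by (simp_all add: X_def Y_def Z_def)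
    moreover have "card (cut (sym_diff S U)) \<le> card (cut S)" using S(1) U by (intro S(2)) auto
    ultimately have "card Y \<le> card X" by (simp add: card_Un_disjoint)
    then show ?thesis by (simp add: X_def Y_def)
  qed
  with S(1) show ?thesis by blast
qed

text \<open>An even number of vertices makes the two sides of any cut of \<open>B\<close> differ in
  parity; having at least three ensures that no vertex is alone in \<open>B\<close>.\<close>

lemma finite_graph_123:
  assumes G: "graph_in Q" and finV: "finite (verts Q)" and conn: "set_connected (verts Q) (edges Q)"
    and card: "even (card (verts Q))" "card (verts Q) \<ge> 3"
  shows "\<exists>w. solution_123 Q w"
proof -
  define d where "d v = card (neighbours Q v)" for v
  have finE: "finite (edges Q)"
    using G finV by (intro finite_subset[of "edges Q" "Pow (verts Q)"]) (auto simp: graph_in_def)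
  have d_edges: "d u = card {e \<in> edges Q. u \<in> e}" for u
    unfolding d_def by (rule card_neighbours[OF G])
  have "verts Q \<noteq> {}" using card by auto
  then obtain z where z: "z \<in> verts Q" and conn_z: "set_connected (verts Q - {z}) (edges Q)"
    and extr: "(\<forall>u\<in>verts Q. {u, z} \<in> edges Q \<longrightarrow> d u \<le> d z) \<or>
      (\<forall>u\<in>verts Q. {u, z} \<in> edges Q \<longrightarrow> d z \<le> d u)"
    using noncut_local_extremum[OF finV _ conn, of d] by blast
  define B where "B = verts Q - {z}"
  define E where "E = {e \<in> edges Q. z \<notin> e}"
  have finB: "finite B" and finE': "finite E" using finV finE by (simp_all add: B_def E_def)
  have cardB: "card B + 1 = card (verts Q)"
    using z finV card_Suc_Diff1[of "verts Q" z] by (simp add: B_def)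
  have "\<forall>e\<in>E. \<exists>p. fst p \<in> B \<and> snd p \<in> B \<and> fst p \<noteq> snd p \<and> e = {fst p, snd p}"
  proof
    fix e assume e: "e \<in> E"
    then have "e \<in> edges Q" by (simp add: E_def)
    then obtain a b where "a \<in> verts Q" "b \<in> verts Q" "a \<noteq> b" "e = {a, b}"
      by (rule graph_inE[OF G])
    then show "\<exists>p. fst p \<in> B \<and> snd p \<in> B \<and> fst p \<noteq> snd p \<and> e = {fst p, snd p}"
      using e by (intro exI[of _ "(a, b)"]) (auto simp: B_def E_def)
  qed
  then obtain p where p: "\<forall>e\<in>E. fst (p e) \<in> B \<and> snd (p e) \<in> B \<and> fst (p e) \<noteq> snd (p e) \<and>
      e = {fst (p e), snd (p e)}"
    unfolding bchoice_iff by (elim exE)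
  obtain S where S: "S \<subseteq> B" and S_max: "\<forall>U\<subseteq>B.
      card {e \<in> E. \<not> crosses (\<lambda>e. fst (p e)) (\<lambda>e. snd (p e)) S e \<and>
        crosses (\<lambda>e. fst (p e)) (\<lambda>e. snd (p e)) U e} \<le>
      card {e \<in> E. crosses (\<lambda>e. fst (p e)) (\<lambda>e. snd (p e)) S e \<and>
        crosses (\<lambda>e. fst (p e)) (\<lambda>e. snd (p e)) U e}"
    using max_cut_crossing[OF finB finE', where h = "\<lambda>e. fst (p e)" and t = "\<lambda>e. snd (p e)"]
    by (elim exE conjE)
  \<comment> \<open>Cut edges are oriented out of \<open>S\<close>. Then, up to a sign that depends
    only on the side of the vertex, the incidence of a cut edge at a vertex is 1 or 0 according to
    whether the vertex is one of its ends.\<close>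
  define h where "h e = (if fst (p e) \<in> S then fst (p e) else snd (p e))" for e
  define t where "t e = (if fst (p e) \<in> S then snd (p e) else fst (p e))" for e
  have cross: "crosses h t U e \<longleftrightarrow> crosses (\<lambda>e. fst (p e)) (\<lambda>e. snd (p e)) U e" for U e
    by (auto simp: crosses_def h_def t_def)
  have ends: "h e \<in> B" "t e \<in> B" "h e \<noteq> t e" "e = {h e, t e}" if "e \<in> E" for e
    using bspec[OF p that] by (auto simp: h_def t_def insert_commute)
  define H where "H = {e \<in> E. crosses h t S e}"
  define I where "I = {e \<in> E. \<not> crosses h t S e}"
  have finH: "finite H" and finI: "finite I" using finE' by (simp_all add: H_def I_def)
  have HI: "H \<union> I = E" "H \<inter> I = {}" by (auto simp: H_def I_def)
  have H_ends: "h e \<in> S" "t e \<notin> S" if "e \<in> H" for e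
    using that unfolding H_def crosses_def h_def t_def by (auto split: if_splits)
  have I_ends: "h e \<in> S \<longleftrightarrow> t e \<in> S" if "e \<in> I" for e
    using that by (auto simp: I_def crosses_def)
  have connB: "cut_connected B h t (H \<union> I)"
    unfolding cut_connected_def
  proof (intro allI impI)
    fix U assume U: "U \<noteq> {}" "U \<subset> B"
    then obtain u v where uv: "u \<in> U" "v \<in> B - U" "{u, v} \<in> edges Q"
      using conn_z unfolding set_connected_def B_def by meson
    then have "{u, v} \<in> E" using U by (auto simp: E_def B_def)
    moreover from ends(4)[OF this] have "crosses h t U {u, v}"
      using uv by (auto simp: crosses_def doubleton_eq_iff)
    ultimately show "\<exists>e\<in>H \<union> I. crosses h t U e" unfolding HI by blast
  qed
  obtain F b where F: "F \<subseteq> H" "cut_connected B h t ((H - F) \<union> I)" "bij_betw b I F"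
    and perm: "permanent I (\<lambda>i k. incidence h t (b k) (h i) - incidence h t (b k) (t i)) \<noteq> 0"
  proof (rule nonvanishing_selection[OF finB finH finI, of h t])
    show "h e \<in> B \<and> t e \<in> B" if "e \<in> H \<union> I" for e using ends[of e] that HI by blast
    show "h i \<noteq> t i" if "i \<in> I" for i using ends[of i] that HI by blast
    show "card {i \<in> I. crosses h t U i} \<le> card {e \<in> H. crosses h t U e}" if "U \<noteq> {}" "U \<subset> B" for U
      using S_max[rule_format, of U] that by (simp add: H_def I_def cross conj_assoc)
  qed (use connB in blast)+
  \<comment> \<open>the vertices of \<open>B\<close> whose weighted degree is going to be odd\<close>
  obtain P where P: "P = S \<or> P = B - S" "even (card P + d z)"
  proof -
    have "card B = card S + card (B - S)"
      using S finB by (simp add: card_Diff_subset finite_subset card_mono)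
    \<comment> \<open>\<open>card B\<close> is odd, so one of the two sides has the parity of
      \<open>d z\<close>, which is what makes \<open>T\<close> even.\<close>
    then have "odd (card S + card (B - S))" using cardB card(1) by presburger
    then have "even (card S + d z) \<or> even (card (B - S) + d z)" by auto
    then show thesis using that by blast
  qed
  have P_sub: "P \<subseteq> B" using P(1) S by auto
  \<comment> \<open>Making the weights on \<open>J\<close> even and all others odd flips the parity
    of a vertex once per edge of \<open>J\<close>, starting from that of \<open>d u\<close>;
    \<open>T\<close> collects the vertices that need an odd number of flips.\<close>
  define T where "T = {u \<in> B. odd (d u) \<noteq> (u \<in> P)}"
  have "even (card T)"
  proof -
    have "T = sym_diff {u \<in> B. odd (d u)} P" using P_sub by (auto simp: T_def)
    moreover have "finite P" using P_sub finB by (rule finite_subset)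
    ultimately have "odd (card T) \<longleftrightarrow> odd (card {u \<in> B. odd (d u)}) \<noteq> odd (card P)"
      using odd_card_sym_diff[of "{u \<in> B. odd (d u)}" P] finB by simp
    moreover have "even (card {u \<in> B. odd (d u)}) \<longleftrightarrow> even (\<Sum>u\<in>B. d u)"
      using even_sum_iff[OF finB, of d] by simp
    moreover have "(\<Sum>u\<in>B. d u) = 2 * card E + d z"
      unfolding B_def E_def d_def by (rule handshake_delete[OF G finV z])
    ultimately show ?thesis using P(2) by auto
  qed
  then have "\<exists>J\<subseteq>(H - F) \<union> I. \<forall>v\<in>B. odd (card {e \<in> J. v = h e \<or> v = t e}) \<longleftrightarrow> v \<in> T"
    using finH finI finB ends HI by (intro parity_join[OF _ _ F(2)]) (auto simp: T_def)
  then obtain J where J: "J \<subseteq> (H - F) \<union> I"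
    "\<And>v. v \<in> B \<Longrightarrow> odd (card {e \<in> J. v = h e \<or> v = t e}) \<longleftrightarrow> v \<in> T" by blast
  \<comment> \<open>All edges at \<open>z\<close> get weight \<open>m\<close>, so its weighted
    degree is \<open>m * d z\<close>. With 3 at a vertex of locally largest degree, or 1 at one of
    locally smallest degree, a neighbour differs as soon as it has an edge of another weight; hence
    the opposite value \<open>4 - m\<close> off \<open>J\<close> and \<open>F\<close>.\<close>
  define m :: nat where "m = (if \<forall>u\<in>verts Q. {u, z} \<in> edges Q \<longrightarrow> d u \<le> d z then 3 else 1)"
  \<comment> \<open>on \<open>F\<close> the weight 1 may still be raised to 3\<close>
  define w0 where "w0 e = (if z \<in> e then m else if e \<in> J then 2 else if e \<in> F then 1 else 4 - m)" for e
  define s0 where "s0 u = (\<Sum>e | e \<in> edges Q \<and> u \<in> e. w0 e)" for u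
  define \<sigma> :: "'a \<Rightarrow> real" where "\<sigma> u = (if u \<in> S then 1 else - 1)" for u
  \<comment> \<open>A switched edge adds 2 at each of its ends, hence the division by 2. Both ends
    of an inner edge are on the same side of the cut, so the single sign
    \<open>\<sigma> (h i)\<close> serves for both.\<close>
  obtain A where A: "A \<subseteq> I" and A_nz: "\<And>i. i \<in> I \<Longrightarrow> \<sigma> (h i) * (real (s0 (h i)) - real (s0 (t i))) / 2 +
      (\<Sum>k\<in>A. incidence h t (b k) (h i) - incidence h t (b k) (t i)) \<noteq> 0"
    using avoid_zeros[OF finI perm, of "\<lambda>i. \<sigma> (h i) * (real (s0 (h i)) - real (s0 (t i))) / 2"] by blast
  have finA: "finite A" using A finI finite_subset by blast
  have bA: "b ` A \<subseteq> F" "inj_on b A"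
    using A F(3) by (auto simp: bij_betw_def intro: inj_on_subset)
  have F_facts: "e \<in> E" "e \<notin> J" "z \<notin> e" "e \<in> edges Q" if "e \<in> F" for e
    using that F(1) J(1) HI by (auto simp: E_def)
  define w where "w e = w0 e + (if e \<in> b ` A then 2 else 0)" for e
  define s where "s u = (\<Sum>e | e \<in> edges Q \<and> u \<in> e. w e)" for u
  have s_degree: "weighted_degree Q w u = s u" for u
    unfolding weighted_degree_def s_def by (rule sum_neighbours[OF G])
  have m: "m = 1 \<or> m = 3" by (simp add: m_def)
  have w_range: "w e \<in> {1, 2, 3}" for e
    using m F_facts[of e] bA by (auto simp: w_def w0_def)
  have w_bounds: "1 \<le> w e" "w e \<le> 3" for e using w_range[of e] by auto
  have odd_w: "odd (w e) \<longleftrightarrow> e \<notin> J" if "e \<in> edges Q" for e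
    using m J(1) HI by (auto simp: w_def w0_def E_def)
  have odd_s: "odd (s u) \<longleftrightarrow> u \<in> P" if u: "u \<in> B" for u
  proof -
    have "odd (s u) \<longleftrightarrow> odd (card {e \<in> {e \<in> edges Q. u \<in> e}. odd (w e)})"
      unfolding s_def using even_sum_iff[of "{e \<in> edges Q. u \<in> e}" w] finE by simp
    also have "{e \<in> {e \<in> edges Q. u \<in> e}. odd (w e)} =
        sym_diff {e \<in> edges Q. u \<in> e} {e \<in> J. u = h e \<or> u = t e}"
    proof -
      have "u \<in> e \<longleftrightarrow> u = h e \<or> u = t e" "e \<in> edges Q" if "e \<in> J" for e
        using ends(4)[of e] that J(1) HI by (auto simp: E_def)
      then show ?thesis using odd_w by auto
    qed
    also have "odd (card \<dots>) \<longleftrightarrow> odd (d u) \<noteq> (u \<in> T)"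
      using finE J(1) finH finI J(2)[OF u] finite_subset[OF J(1)]
      by (simp add: odd_card_sym_diff d_edges)
    finally show ?thesis using u by (auto simp: T_def)
  qed
  have s_split: "s u = s0 u + 2 * card {k \<in> A. u \<in> b k}" for u
  proof -
    have "s u = s0 u + (\<Sum>e | e \<in> edges Q \<and> u \<in> e. if e \<in> b ` A then 2 else 0)"
      by (simp add: s_def s0_def w_def sum.distrib)
    also have "(\<Sum>e | e \<in> edges Q \<and> u \<in> e. if e \<in> b ` A then 2 else 0) =
        2 * card ({e \<in> edges Q. u \<in> e} \<inter> b ` A)"
      using finE by (simp add: sum.If_cases)
    also have "{e \<in> edges Q. u \<in> e} \<inter> b ` A = b ` {k \<in> A. u \<in> b k}" using bA F_facts by auto
    also have "card \<dots> = card {k \<in> A. u \<in> b k}"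
      using bA by (intro card_image) (auto intro: inj_on_subset)
    finally show ?thesis .
  qed
  have incid: "real (card {k \<in> A. u \<in> b k}) = \<sigma> u * (\<Sum>k\<in>A. incidence h t (b k) u)" for u
  proof -
    have "real (card {k \<in> A. u \<in> b k}) = (\<Sum>k\<in>A. if u \<in> b k then 1 else 0)"
      using finA by (simp add: sum.If_cases Int_def)
    also have "\<dots> = (\<Sum>k\<in>A. \<sigma> u * incidence h t (b k) u)"
    proof (intro sum.cong refl)
      fix k assume "k \<in> A"
      then have "b k \<in> H" using bA F by auto
      then have k: "h (b k) \<in> S" "t (b k) \<notin> S" "b k = {h (b k), t (b k)}"
        using H_ends ends(4) HI by blast+
      then have "u \<in> b k \<longleftrightarrow> u = h (b k) \<or> u = t (b k)" by blast
      moreover have "(if u = x \<or> u = y then 1 else 0) =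
          \<sigma> u * ((if u = x then 1 else 0) - (if u = y then 1 else 0))" if "x \<in> S" "y \<notin> S" for x y
        using that by (cases "u = x"; cases "u = y"; cases "u \<in> S") (simp_all add: \<sigma>_def)
      ultimately show "(if u \<in> b k then 1 else 0) = \<sigma> u * incidence h t (b k) u"
        unfolding incidence_def using k(1,2) by presburger
    qed
    finally show ?thesis by (simp add: sum_distrib_left)
  qed
  have I_diff: "s (h i) \<noteq> s (t i)" if i: "i \<in> I" for i
  proof
    assume "s (h i) = s (t i)"
    then have "real (s (h i)) = real (s (t i))" by simp
    moreover have "\<sigma> (t i) = \<sigma> (h i)" using I_ends[OF i] by (simp add: \<sigma>_def)
    ultimately have eq: "real (s0 (h i)) - real (s0 (t i)) =
        - 2 * \<sigma> (h i) * (\<Sum>k\<in>A. incidence h t (b k) (h i) - incidence h t (b k) (t i))"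
      by (simp add: s_split incid sum_subtractf algebra_simps)
    have "\<sigma> (h i) * \<sigma> (h i) = 1" by (simp add: \<sigma>_def)
    then have "\<sigma> (h i) * (real (s0 (h i)) - real (s0 (t i))) / 2 =
        - (\<Sum>k\<in>A. incidence h t (b k) (h i) - incidence h t (b k) (t i))"
      unfolding eq by (simp add: algebra_simps)
    with A_nz[OF i] show False by simp
  qed
  have H_diff: "s (h e) \<noteq> s (t e)" if e: "e \<in> H" for e
  proof -
    have "(h e \<in> P) \<noteq> (t e \<in> P)" using P(1) H_ends[OF e] ends[of e] e HI by blast
    then show ?thesis using odd_s[of "h e"] odd_s[of "t e"] ends[of e] e HI by auto
  qed
  have z_diff: "s u \<noteq> s z" if uz: "{u, z} \<in> edges Q" for u
  proof -
    have u: "u \<in> B" using uz G unfolding graph_in_def B_def by (auto simp: doubleton_eq_iff)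
    have "s z = (\<Sum>e | e \<in> edges Q \<and> z \<in> e. m)"
      unfolding s_def using bA F_facts by (intro sum.cong) (auto simp: w_def w0_def)
    then have sz: "s z = m * d z" by (simp add: d_edges)
    \<comment> \<open>Connectivity after removal of \<open>F\<close> gives \<open>u\<close> an edge
      inside \<open>B\<close> outside \<open>F\<close>; its weight 2 or \<open>4 - m\<close> differs
      from \<open>m\<close> and makes the comparison with \<open>z\<close> strict.\<close>
    have "{u} \<subset> B"
    proof -
      have "card B \<ge> 2" using cardB card(2) by linarith
      then have "B \<noteq> {u}" by auto
      with u show ?thesis by blast
    qed
    then obtain e where e: "e \<in> (H - F) \<union> I" "crosses h t {u} e"
      using cut_connectedD[OF F(2), of "{u}"] by blast
    have eE: "e \<in> E" "e \<notin> F" using e(1) HI F(1) by auto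
    have eu: "e \<in> {e \<in> edges Q. u \<in> e}"
      using ends(4)[OF eE(1)] e(2) eE(1) by (auto simp: crosses_def E_def)
    have we: "w e = 2 \<or> w e = 4 - m"
      using eE bA by (auto simp: w_def w0_def E_def)
    show ?thesis
    proof (cases "\<forall>u\<in>verts Q. {u, z} \<in> edges Q \<longrightarrow> d u \<le> d z")
      case True
      then have m3: "m = 3" by (simp add: m_def)
      have "s u < (\<Sum>e | e \<in> edges Q \<and> u \<in> e. 3)"
        unfolding s_def
      proof (rule sum_strict_mono_ex1)
        show "\<forall>e\<in>{e \<in> edges Q. u \<in> e}. w e \<le> 3" using w_bounds by simp
        show "\<exists>e\<in>{e \<in> edges Q. u \<in> e}. w e < 3" using eu we m3 by force
      qed (use finE in simp)
      also have "\<dots> = 3 * d u" by (simp add: d_edges)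
      also have "\<dots> \<le> s z" using True uz u by (simp add: sz m3 B_def)
      finally show ?thesis by simp
    next
      case False
      then have m1: "m = 1" by (simp add: m_def)
      have "s z \<le> d u" using False extr uz u by (auto simp: sz m1 B_def)
      also have "d u = (\<Sum>e | e \<in> edges Q \<and> u \<in> e. 1)" by (simp add: d_edges)
      also have "\<dots> < s u"
        unfolding s_def
      proof (rule sum_strict_mono_ex1)
        show "\<forall>e\<in>{e \<in> edges Q. u \<in> e}. 1 \<le> w e" using w_bounds by simp
        show "\<exists>e\<in>{e \<in> edges Q. u \<in> e}. 1 < w e" using eu we m1 by force
      qed (use finE in simp)
      finally show ?thesis by simp
    qed
  qed
  have "s u \<noteq> s v" if uv: "{u, v} \<in> edges Q" for u v
  proof (cases "{u, v} \<in> E")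
    case True
    have "s (h {u, v}) \<noteq> s (t {u, v})" using True HI H_diff I_diff by blast
    then show ?thesis using ends(4)[OF True] by (auto simp: doubleton_eq_iff)
  next
    case False
    then have "u = z \<or> v = z" using uv by (auto simp: E_def)
    then show ?thesis using z_diff[of u] z_diff[of v] uv by (auto simp: insert_commute)
  qed
  then show ?thesis
    using w_range s_degree by (intro exI[of _ w]) (auto simp: solution_123_def)
qed

section \<open>Periodic graphs\<close>

text \<open>For a finite basis \<open>B\<close>, this is the lattice generated by the vectors
  \<open>k *\<^sub>R b\<close> with \<open>b\<close> in \<open>B\<close>, described through
  coordinates.\<close>

definition lattice_mult :: "'a::real_vector set \<Rightarrow> real \<Rightarrow> 'a set" where
  "lattice_mult B k = {x. \<forall>b\<in>B. \<exists>n::int. representation B x b = k * of_int n}"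

lemma add_subgroup_lattice_mult:
  assumes "independent B" "span B = UNIV"
  shows "add_subgroup (lattice_mult B k)"
  unfolding add_subgroup_def lattice_mult_def mem_Collect_eq
proof (intro conjI ballI impI)
  have span: "x \<in> span B" for x using assms(2) by simp
  show "\<exists>n::int. representation B 0 b = k * of_int n" for b
    by (intro exI[of _ 0]) (simp add: representation_zero)
  fix x b assume b: "b \<in> B" and "x \<in> {x. \<forall>b\<in>B. \<exists>n::int. representation B x b = k * of_int n}"
  then obtain n :: int where n: "representation B x b = k * of_int n" by blast
  show "\<exists>n::int. representation B (- x) b = k * of_int n"
    using n by (intro exI[of _ "- n"]) (simp add: representation_neg[OF assms(1) span])
  fix y assume "y \<in> {x. \<forall>b\<in>B. \<exists>n::int. representation B x b = k * of_int n}"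
  then obtain m :: int where m: "representation B y b = k * of_int m" using b by blast
  show "\<exists>n::int. representation B (x + y) b = k * of_int n"
    using n m
    by (intro exI[of _ "n + m"]) (simp add: representation_add[OF assms(1) span span] algebra_simps)
qed

lemma add_subgroup_scaleR_int:
  assumes "add_subgroup H" "(x::'a::real_vector) \<in> H"
  shows "of_int n *\<^sub>R x \<in> H"
proof -
  have nat: "of_nat m *\<^sub>R x \<in> H" for m
    using assms by (induction m) (auto simp: add_subgroup_def algebra_simps)
  show ?thesis
  proof (cases "n \<ge> 0")
    case True
    then show ?thesis using nat[of "nat n"] by simp
  next
    case False
    have "- (of_nat (nat (- n)) *\<^sub>R x) \<in> H" using nat assms(1) unfolding add_subgroup_def by blast
    then show ?thesis using False by simp
  qed
qed

lemma lattice_mult_1_subset: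
  assumes "independent B" "span B = UNIV" "finite B" "add_subgroup H" "B \<subseteq> H"
  shows "lattice_mult B 1 \<subseteq> H"
proof
  fix x assume x: "x \<in> lattice_mult B 1"
  have "(\<Sum>b\<in>C. representation B x b *\<^sub>R b) \<in> H" if "C \<subseteq> B" for C
    using finite_subset[OF that assms(3)] that
  proof (induction C rule: finite_induct)
    case empty
    then show ?case using assms(4) by (simp add: add_subgroup_def)
  next
    case (insert b C)
    then obtain n :: int where "representation B x b = of_int n"
      using x by (auto simp: lattice_mult_def)
    then have "representation B x b *\<^sub>R b \<in> H"
      using add_subgroup_scaleR_int[OF assms(4), of b n] insert.prems assms(5) by auto
    then show ?case using insert assms(4) by (simp add: add_subgroup_def)
  qed
  from this[OF order_refl] show "x \<in> H"
    using sum_representation_eq[OF assms(1) _ assms(3) order_refl, of x] assms(2) by simp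
qed

lemma lattice_mult_antimono:
  "lattice_mult B (k * of_int m) \<subseteq> lattice_mult B k"
proof
  fix x assume x: "x \<in> lattice_mult B (k * of_int m)"
  show "x \<in> lattice_mult B k"
    unfolding lattice_mult_def
  proof (intro CollectI ballI)
    fix b assume "b \<in> B"
    then obtain n :: int where "representation B x b = k * of_int m * of_int n"
      using x by (auto simp: lattice_mult_def)
    then show "\<exists>n::int. representation B x b = k * of_int n" by (intro exI[of _ "m * n"]) simp
  qed
qed

lemma scaleR_basis_in_lattice_mult:
  assumes "independent B" "span B = UNIV" "b \<in> B"
  shows "c *\<^sub>R b \<in> lattice_mult B k \<longleftrightarrow> (\<exists>n::int. c = k * of_int n)"
proof -
  have rep: "representation B (c *\<^sub>R b) a = (if a = b then c else 0)" for a
    using assms by (simp add: representation_scale representation_basis)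
  show ?thesis
  proof
    assume "c *\<^sub>R b \<in> lattice_mult B k"
    then have "\<exists>n::int. representation B (c *\<^sub>R b) b = k * of_int n"
      using assms(3) unfolding lattice_mult_def by blast
    then show "\<exists>n::int. c = k * of_int n" by (simp only: rep refl if_True)
  next
    assume c: "\<exists>n::int. c = k * of_int n"
    have n: "\<exists>n::int. representation B (c *\<^sub>R b) a = k * of_int n" for a
      unfolding rep using c by (cases "a = b") (auto intro: exI[of _ 0])
    then show "c *\<^sub>R b \<in> lattice_mult B k"
      unfolding lattice_mult_def by (intro CollectI ballI n)
  qed
qed

lemma span_lattice_mult:
  assumes "independent B" "span B = UNIV" "k \<noteq> 0"
  shows "span (lattice_mult B k) = UNIV"
proof -
  have "b \<in> span (lattice_mult B k)" if "b \<in> B" for b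
  proof -
    have "k *\<^sub>R b \<in> lattice_mult B k"
      unfolding scaleR_basis_in_lattice_mult[OF assms(1,2) that] by (rule exI[of _ 1]) simp
    then have "(1 / k) *\<^sub>R k *\<^sub>R b \<in> span (lattice_mult B k)"
      by (intro span_scale span_base)
    then show ?thesis using assms(3) by simp
  qed
  then have "span B \<subseteq> span (lattice_mult B k)" by (intro span_minimal subspace_span) auto
  then show ?thesis using assms(2) by auto
qed

text \<open>Rounding the coordinates down to multiples of \<open>k\<close> leaves a point of the
  fundamental parallelepiped of the lattice.\<close>

lemma translate_into_box:
  fixes x :: "'a::real_normed_vector"
  assumes "independent B" "span B = UNIV" "finite B" "k > 0"
  obtains t where "t \<in> lattice_mult B k" "t + x \<in> cball 0 (k * (\<Sum>b\<in>B. norm b))"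
proof -
  define n where "n b = \<lfloor>representation B x b / k\<rfloor>" for b
  define t where "t = - (\<Sum>b\<in>B. (k * of_int (n b)) *\<^sub>R b)"
  define f where "f b = representation B x b - k * of_int (n b)" for b
  have in_span: "v \<in> span B" for v using assms(2) by simp
  have f: "0 \<le> f b" "f b \<le> k" for b
  proof -
    have "of_int (n b) \<le> representation B x b / k" "representation B x b / k \<le> of_int (n b) + 1"
      unfolding n_def by linarith+
    then show "0 \<le> f b" "f b \<le> k" using assms(4) by (simp_all add: f_def field_simps)
  qed
  have "x = (\<Sum>b\<in>B. representation B x b *\<^sub>R b)"
    using sum_representation_eq[OF assms(1) in_span assms(3) order_refl] by simp
  then have "t + x = (\<Sum>b\<in>B. f b *\<^sub>R b)"
    by (simp add: t_def f_def algebra_simps sum_subtractf)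
  also have "norm \<dots> \<le> (\<Sum>b\<in>B. k * norm b)"
    using f by (intro norm_sum[THEN order_trans] sum_mono) (simp add: mult_right_mono)
  finally have "t + x \<in> cball 0 (k * (\<Sum>b\<in>B. norm b))" by (simp add: sum_distrib_left)
  moreover have "t \<in> lattice_mult B k"
  proof -
    have sg: "add_subgroup (lattice_mult B k)" by (rule add_subgroup_lattice_mult[OF assms(1,2)])
    have "(\<Sum>b\<in>C. (k * of_int (n b)) *\<^sub>R b) \<in> lattice_mult B k" if "C \<subseteq> B" for C
      using finite_subset[OF that assms(3)] that
    proof (induction C rule: finite_induct)
      case empty
      then show ?case using sg by (simp add: add_subgroup_def)
    next
      case (insert b C)
      then have "(k * of_int (n b)) *\<^sub>R b \<in> lattice_mult B k"
        using scaleR_basis_in_lattice_mult[OF assms(1,2), of b] by blast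
      then show ?case using insert sg by (simp add: add_subgroup_def)
    qed
    then show ?thesis using sg by (simp add: t_def add_subgroup_def)
  qed
  ultimately show thesis using that by blast
qed

lemma even_card_involution:
  assumes "finite X" "\<And>x. x \<in> X \<Longrightarrow> f x \<in> X \<and> f (f x) = x \<and> f x \<noteq> x"
  shows "even (card X)"
  using assms
proof (induction "card X" arbitrary: X rule: less_induct)
  case less
  show ?case
  proof (cases "X = {}")
    case False
    then obtain x where x: "x \<in> X" by blast
    define Y where "Y = X - {x, f x}"
    have fx: "f x \<in> X" "f (f x) = x" "f x \<noteq> x" using less.prems(2)[OF x] by auto
    have card: "card X = card Y + 2"
      using x fx less.prems(1) card_Diff_subset[of "{x, f x}" X] card_mono[of X "{x, f x}"]
      by (simp add: Y_def)
    have "even (card Y)"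
    proof (rule less.hyps)
      show "finite Y" "card Y < card X" using less.prems(1) card by (auto simp: Y_def)
      fix y assume y: "y \<in> Y"
      then have fy: "f y \<in> X" "f (f y) = y" "f y \<noteq> y" using less.prems(2)[of y] by (auto simp: Y_def)
      have "f y \<noteq> x" "f y \<noteq> f x" using y fx fy by (auto simp: Y_def)
      with fy show "f y \<in> Y \<and> f (f y) = y \<and> f y \<noteq> y" by (simp add: Y_def)
    qed
    then show ?thesis using card by simp
  qed simp
qed

section \<open>Translations by periods and quotient graphs\<close>

lemma mem_verts_translate:
  assumes "t \<in> periods G"
  shows "t + u \<in> verts G \<longleftrightarrow> u \<in> verts G"
proof -
  have "verts G = (+) t ` verts G"
    using assms unfolding periods_def translate_graph_def by (metis (mono_tags) mem_Collect_eq ugraph.select_convs(1))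
  then show ?thesis by (metis (mono_tags) add_left_imp_eq imageE imageI)
qed

lemma mem_edges_translate:
  assumes "t \<in> periods G"
  shows "{t + u, t + v} \<in> edges G \<longleftrightarrow> {u, v} \<in> edges G"
proof -
  have step: "{s + u, s + v} \<in> edges G" if "s \<in> periods G" "{u, v} \<in> edges G" for s u v
  proof -
    have "edges G = translate_edge s ` edges G"
      using that(1) unfolding periods_def translate_graph_def
      by (metis (mono_tags) mem_Collect_eq ugraph.select_convs(2))
    moreover have "translate_edge s {u, v} = {s + u, s + v}" by (simp add: translate_edge_def)
    ultimately show ?thesis using that(2) by (metis imageI)
  qed
  have "- t \<in> periods G" using add_subgroup_periods[of G] assms by (simp add: add_subgroup_def)
  from step[OF this, of "t + u" "t + v"] step[OF assms, of u v] show ?thesis by auto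
qed

lemma neighbours_translate:
  assumes "t \<in> periods G"
  shows "t + v \<in> neighbours G (t + u) \<longleftrightarrow> v \<in> neighbours G u"
  unfolding neighbours_def using mem_edges_translate[OF assms] by simp

text \<open>A walk in \<open>G\<close> from a vertex mapped into \<open>U\<close> to one mapped
  outside has a step that leaves \<open>U\<close>, and the image of this step is the required
  edge.\<close>

lemma graph_connected_quotient:
  assumes "graph_in G" "graph_connected G"
  shows "set_connected (f ` verts G) ((`) f ` edges G)"
  unfolding set_connected_def
proof (intro allI impI)
  fix U assume U: "U \<noteq> {}" "U \<subset> f ` verts G"
  then obtain u where u: "u \<in> verts G" "f u \<in> U" by blast
  obtain v where v: "v \<in> verts G" "f v \<notin> U" using U by blast
  show "\<exists>x\<in>U. \<exists>y\<in>f ` verts G - U. {x, y} \<in> (`) f ` edges G"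
  proof (rule ccontr)
    assume contra: "\<not> ?thesis"
    have "(u, v) \<in> {(x, y). {x, y} \<in> edges G}\<^sup>*"
      using assms(2) u v by (auto simp: graph_connected_def)
    then have "f v \<in> U"
    proof (induction rule: rtrancl_induct)
      case (step y z)
      then have yz: "{y, z} \<in> edges G" by simp
      then have "z \<in> verts G" by (rule graph_inE[OF assms(1)]) (auto simp: doubleton_eq_iff)
      moreover have "{f y, f z} \<in> (`) f ` edges G" using imageI[OF yz, of "(`) f"] by simp
      ultimately show ?case using contra step.IH by blast
    qed (rule u)
    with v show False by blast
  qed
qed

text \<open>The hypothesis \<open>lift\<close> is the covering property of an orbit map: edges at
  other vertices of the fibre can be moved to \<open>u\<close>. Combined with injectivity on
  neighbourhoods it makes weighted degrees agree with those in the quotient.\<close>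

lemma neighbours_quotient:
  assumes "graph_in G"
    and lift: "\<And>a b. {a, b} \<in> edges G \<Longrightarrow> f a = f u \<Longrightarrow> \<exists>v\<in>neighbours G u. f v = f b"
  shows "neighbours \<lparr>verts = f ` verts G, edges = (`) f ` edges G\<rparr> (f u) = f ` neighbours G u"
proof (intro equalityI subsetI)
  fix x assume "x \<in> neighbours \<lparr>verts = f ` verts G, edges = (`) f ` edges G\<rparr> (f u)"
  then obtain e where e: "e \<in> edges G" "{f u, x} = f ` e" by (auto simp: neighbours_def)
  obtain a b where ab: "a \<in> verts G" "b \<in> verts G" "a \<noteq> b" "e = {a, b}"
    by (rule graph_inE[OF assms(1) e(1)])
  then have "(f a = f u \<and> f b = x) \<or> (f b = f u \<and> f a = x)"
    using e(2) by (auto simp: doubleton_eq_iff)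
  moreover have "{a, b} \<in> edges G" "{b, a} \<in> edges G" using e(1) ab(4) by (simp_all add: insert_commute)
  ultimately have "\<exists>v\<in>neighbours G u. f v = x" using lift[of a b] lift[of b a] by auto
  then show "x \<in> f ` neighbours G u" by auto
next
  fix x assume "x \<in> f ` neighbours G u"
  then obtain v where v: "{u, v} \<in> edges G" "x = f v" by (auto simp: neighbours_def)
  then show "x \<in> neighbours \<lparr>verts = f ` verts G, edges = (`) f ` edges G\<rparr> (f u)"
    using imageI[OF v(1), of "(`) f"] by (simp add: neighbours_def)
qed


theorem theorem3p1:
  fixes G :: "(real ^ 'd) ugraph"
  assumes "graph_in G"
    and "verts G \<noteq> {}"
    and "fully_periodic G"
    and "graph_connected G"
    and "graph_locally_finite G"
  shows "\<exists>w. solution_123 G w \<and> fully_periodic_weights G w"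
proof -
  obtain B where B: "B \<subseteq> periods G" "independent B" "periods G \<subseteq> span B"
    using maximal_independent_subset[of "periods G"] by blast
  have spanB: "span B = UNIV"
    using assms(3) span_minimal[OF B(3) subspace_span] by (auto simp: fully_periodic_def)
  have in_span: "x \<in> span B" for x using spanB by simp
  have finB: "finite B" using independent_imp_finite[OF B(2)] .
  define R where "R k = k * (\<Sum>b\<in>B. norm b)" for k :: real
  have lat1: "lattice_mult B 1 \<subseteq> periods G"
    by (rule lattice_mult_1_subset[OF B(2) spanB finB add_subgroup_periods B(1)])
  have fin_ball: "finite (verts G \<inter> cball 0 r)" for r
    using assms(5) by (simp add: graph_locally_finite_def)
  define N where "N u = insert u (neighbours G u)" for u
  have finN: "finite (N u)" if "u \<in> verts G" for u
    using assms(5) that by (simp add: N_def graph_locally_finite_def)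
  \<comment> \<open>up to translation there are only finitely many differences of vertices at distance at most 2,
    so a sufficiently sparse \<open>\<Gamma>\<close> contains none of them but 0\<close>
  define D where "D = (\<Union>u\<in>verts G \<inter> cball 0 (R 1). (\<lambda>(a, b). a - b) ` (N u \<times> N u))"
  have finD: "finite D" unfolding D_def using fin_ball finN by auto
  have diff_D: "a - b \<in> D" if u: "u \<in> verts G" and ab: "a \<in> N u" "b \<in> N u" for u a b
  proof -
    obtain t where t: "t \<in> lattice_mult B 1" "t + u \<in> cball 0 (R 1)"
      unfolding R_def by (rule translate_into_box[OF B(2) spanB finB zero_less_one])
    have tp: "t \<in> periods G" using t lat1 by blast
    have "t + u \<in> verts G \<inter> cball 0 (R 1)" using t u mem_verts_translate[OF tp] by blast
    moreover have "t + a \<in> N (t + u)" "t + b \<in> N (t + u)"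
      using ab by (auto simp: N_def neighbours_translate[OF tp])
    moreover have "a - b = (\<lambda>(a, b). a - b) (t + a, t + b)" by simp
    ultimately show ?thesis unfolding D_def by blast
  qed
  obtain K :: nat where K: "\<And>x b. x \<in> D \<Longrightarrow> b \<in> B \<Longrightarrow> \<bar>representation B x b\<bar> \<le> real K"
  proof -
    define X where "X = (\<lambda>(x, b). \<bar>representation B x b\<bar>) ` (D \<times> B)"
    have "finite X" using finD finB by (simp add: X_def)
    obtain K where "Max (insert 0 X) \<le> real K" using real_arch_simple by blast
    then have "y \<le> real K" if "y \<in> X" for y using \<open>finite X\<close> that by simp
    then show thesis by (intro that[of K]) (auto simp: X_def)
  qed
  \<comment> \<open>\<open>M\<close> exceeds the absolute value of every coordinate of a vector in
    \<open>D\<close>, is even so that it can be halved, and is at least 4 so that 0, 1 and 2 are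
    distinct modulo \<open>M\<close>.\<close>
  define M :: int where "M = 2 * int K + 4"
  define \<Gamma> where "\<Gamma> = lattice_mult B (real_of_int M)"
  have \<Gamma>_sub: "\<Gamma> \<subseteq> lattice_mult B 1" using lattice_mult_antimono[of B 1 M] by (simp add: \<Gamma>_def)
  have \<Gamma>_per: "\<Gamma> \<subseteq> periods G" using \<Gamma>_sub lat1 by blast
  have \<Gamma>_group: "add_subgroup \<Gamma>" unfolding \<Gamma>_def by (rule add_subgroup_lattice_mult[OF B(2) spanB])
  have \<Gamma>_span: "span \<Gamma> = UNIV" unfolding \<Gamma>_def by (rule span_lattice_mult[OF B(2) spanB]) (simp add: M_def)
  have \<Gamma>_closed: "0 \<in> \<Gamma>" "x \<in> \<Gamma> \<Longrightarrow> y \<in> \<Gamma> \<Longrightarrow> x + y \<in> \<Gamma>" "x \<in> \<Gamma> \<Longrightarrow> - x \<in> \<Gamma>" for x y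
    using \<Gamma>_group by (auto simp: add_subgroup_def)
  \<comment> \<open>This keeps the quotient simple and locally like \<open>G\<close>: an edge does
    not become a loop, and two neighbours of a vertex are not identified.\<close>
  have far: "a = b" if u: "u \<in> verts G" and ab: "a \<in> N u" "b \<in> N u" and \<Gamma>: "a - b \<in> \<Gamma>" for u a b
  proof -
    have "representation B (a - b) c = 0" if c: "c \<in> B" for c
    proof -
      obtain n :: int where n: "representation B (a - b) c = real_of_int M * of_int n"
        using \<Gamma> c unfolding \<Gamma>_def lattice_mult_def by blast
      have "\<bar>real_of_int M * of_int n\<bar> \<le> real K" using K[OF diff_D[OF u ab] c] unfolding n .
      then have "real_of_int \<bar>M * n\<bar> \<le> real_of_int (int K)" by simp
      then have le: "\<bar>M\<bar> * \<bar>n\<bar> \<le> int K" by (simp only: of_int_le_iff abs_mult)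
      have "n = 0"
      proof (rule ccontr)
        assume "n \<noteq> 0"
        then have "\<bar>M\<bar> * 1 \<le> \<bar>M\<bar> * \<bar>n\<bar>" by (intro mult_left_mono) auto
        moreover have "int K < \<bar>M\<bar>" by (simp add: M_def)
        ultimately show False using le by linarith
      qed
      then show ?thesis using n by simp
    qed
    then have "a - b = 0"
      using sum_representation_eq[OF B(2) in_span finB order_refl, of "a - b"] by simp
    then show ?thesis by simp
  qed
  define orb where "orb u = (\<lambda>t. t + u) ` \<Gamma>" for u
  have orb_eq: "orb u = orb v \<longleftrightarrow> u - v \<in> \<Gamma>" for u v
  proof
    assume "orb u = orb v"
    moreover have "u \<in> orb u" unfolding orb_def using \<Gamma>_closed(1) by force
    ultimately show "u - v \<in> \<Gamma>" by (auto simp: orb_def)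
  next
    assume uv: "u - v \<in> \<Gamma>"
    have sub: "orb x \<subseteq> orb y" if "x - y \<in> \<Gamma>" for x y
    proof
      fix z assume "z \<in> orb x"
      then obtain t where t: "t \<in> \<Gamma>" "z = t + x" by (auto simp: orb_def)
      then have "t + (x - y) \<in> \<Gamma>" "z = (t + (x - y)) + y" using \<Gamma>_closed(2) that by auto
      then show "z \<in> orb y" unfolding orb_def by blast
    qed
    have "v - u \<in> \<Gamma>" using \<Gamma>_closed(3)[OF uv] by simp
    then show "orb u = orb v" using sub uv by blast
  qed
  have orb_shift: "orb (t + u) = orb u" if "t \<in> \<Gamma>" for t u using that by (simp add: orb_eq)
  define Q where "Q = \<lparr>verts = orb ` verts G, edges = (`) orb ` edges G\<rparr>"
  have edge_verts: "u \<in> verts G" "v \<in> verts G" "u \<noteq> v" if "{u, v} \<in> edges G" for u v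
    using graph_inE[OF assms(1) that] by (auto simp: doubleton_eq_iff)
  have orb_inj: "inj_on orb (N u)" if "u \<in> verts G" for u
    using far[OF that] by (auto simp: inj_on_def orb_eq)
  have orb_edge: "{orb u, orb v} \<in> edges Q" if "{u, v} \<in> edges G" for u v
    using imageI[OF that, of "(`) orb"] by (simp add: Q_def)
  have "graph_in Q"
    unfolding graph_in_def
  proof
    fix e' assume "e' \<in> edges Q"
    then obtain e where e: "e \<in> edges G" "e' = orb ` e" by (auto simp: Q_def)
    obtain u v where uv: "u \<in> verts G" "v \<in> verts G" "u \<noteq> v" "e = {u, v}"
      by (rule graph_inE[OF assms(1) e(1)])
    have "u \<in> N u" "v \<in> N u" using e uv by (auto simp: N_def neighbours_def)
    then have "orb u \<noteq> orb v" using orb_inj[OF uv(1)] uv(3) by (auto dest: inj_onD)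
    then show "\<exists>u\<in>verts Q. \<exists>v\<in>verts Q. u \<noteq> v \<and> e' = {u, v}"
      using e(2) uv by (auto simp: Q_def)
  qed
  moreover have "finite (verts Q)"
  proof (rule finite_subset)
    show "finite (orb ` (verts G \<inter> cball 0 (R (real_of_int M))))" using fin_ball by blast
    have "orb u \<in> orb ` (verts G \<inter> cball 0 (R (real_of_int M)))" if u: "u \<in> verts G" for u
    proof -
      have "real_of_int M > 0" by (simp add: M_def)
      then obtain t where t: "t \<in> \<Gamma>" "t + u \<in> cball 0 (R (real_of_int M))"
        unfolding R_def \<Gamma>_def by (rule translate_into_box[OF B(2) spanB finB])
      then have "t + u \<in> verts G" using mem_verts_translate[of t G u] \<Gamma>_per u by blast
      with t show ?thesis using orb_shift[of t u] by (metis IntI imageI)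
    qed
    then show "verts Q \<subseteq> orb ` (verts G \<inter> cball 0 (R (real_of_int M)))" by (auto simp: Q_def)
  qed
  moreover have "set_connected (verts Q) (edges Q)"
    using graph_connected_quotient[OF assms(1,4), of orb] by (simp add: Q_def)
  moreover have "even (card (verts Q)) \<and> card (verts Q) \<ge> 3"
  proof -
    have "B \<noteq> {}"
    proof
      assume "B = {}"
      then have "(UNIV :: (real ^ 'd) set) = {0}" using spanB by simp
      then show False using nonempty_Basis nonzero_Basis by (metis UNIV_I ex_in_conv singletonD)
    qed
    then obtain b where b: "b \<in> B" by blast
    have b_in: "c *\<^sub>R b \<in> \<Gamma> \<longleftrightarrow> (\<exists>n::int. c = real_of_int M * of_int n)" for c
      unfolding \<Gamma>_def by (rule scaleR_basis_in_lattice_mult[OF B(2) spanB b])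
    have small: "of_int c *\<^sub>R b \<notin> \<Gamma>" if c: "0 < c" "c < M" for c :: int
    proof
      assume "of_int c *\<^sub>R b \<in> \<Gamma>"
      then obtain n :: int where "real_of_int c = real_of_int M * of_int n" unfolding b_in by blast
      then have "c = M * n" by (simp only: of_int_mult[symmetric] of_int_eq_iff)
      then have "M dvd c" by simp
      with c show False using zdvd_not_zless by blast
    qed
    have b_per: "of_int c *\<^sub>R b \<in> periods G" for c :: int
      using add_subgroup_scaleR_int[OF add_subgroup_periods] B(1) b by blast
    \<comment> \<open>The coefficient is half of \<open>M\<close>, so translation by
      \<open>h\<close> acts on orbits as an involution, without fixed points because
      \<open>h\<close> is not in \<open>\<Gamma>\<close>.\<close>
    define h where "h = of_int (int K + 2) *\<^sub>R b"
    have h: "h \<in> periods G" "h \<notin> \<Gamma>" "h + h \<in> \<Gamma>"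
    proof -
      show "h \<in> periods G" unfolding h_def by (rule b_per)
      show "h \<notin> \<Gamma>" unfolding h_def by (rule small) (simp_all add: M_def)
      have hh: "h + h = real_of_int M *\<^sub>R b"
        unfolding h_def scaleR_add_left[symmetric] by (simp add: M_def)
      show "h + h \<in> \<Gamma>" unfolding hh b_in by (rule exI[of _ 1]) simp
    qed
    have "even (card (verts Q))"
    proof (rule even_card_involution[OF \<open>finite (verts Q)\<close>, of "(`) ((+) h)"])
      fix X assume "X \<in> verts Q"
      then obtain u where u: "u \<in> verts G" "X = orb u" by (auto simp: Q_def)
      have shift: "(+) h ` orb v = orb (h + v)" for v
        by (simp add: orb_def image_image add.left_commute)
      have "orb (h + u) \<in> verts Q"
        using u(1) mem_verts_translate[OF h(1), of u] by (simp add: Q_def)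
      moreover have "orb (h + (h + u)) = orb u" using orb_shift[OF h(3), of u] by (simp add: add.assoc)
      moreover have "orb (h + u) \<noteq> orb u" using h(2) by (simp add: orb_eq)
      ultimately show "(+) h ` X \<in> verts Q \<and> (+) h ` (+) h ` X = X \<and> (+) h ` X \<noteq> X"
        unfolding u(2) shift by blast
    qed
    moreover have "card (verts Q) \<ge> 3"
    proof -
      obtain u where u: "u \<in> verts G" using assms(2) by blast
      have "orb (of_int c *\<^sub>R b + u) \<in> verts Q" for c :: int
        using mem_verts_translate[OF b_per, of c u] u by (auto simp: Q_def)
      moreover have "inj_on (\<lambda>c::int. orb (of_int c *\<^sub>R b + u)) {0, 1, 2}"
      proof -
        have "orb (of_int c *\<^sub>R b + u) \<noteq> orb (of_int c' *\<^sub>R b + u)" if "c' < c" "c < c' + 3" for c c' :: int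
          using small[of "c - c'"] that by (simp add: orb_eq M_def scaleR_diff_left)
        note ne = this[of 0 1] this[of 0 2] this[of 1 2]
        show ?thesis using ne by (auto simp: inj_on_def)
      qed
      ultimately have "card ((\<lambda>c::int. orb (of_int c *\<^sub>R b + u)) ` {0, 1, 2}) \<le> card (verts Q)"
        "card ((\<lambda>c::int. orb (of_int c *\<^sub>R b + u)) ` {0, 1, 2}) = card {0, 1, 2 :: int}"
        using \<open>finite (verts Q)\<close> by (blast intro: card_mono, blast intro: card_image)
      then show ?thesis by simp
    qed
    ultimately show ?thesis by blast
  qed
  ultimately obtain w where w: "solution_123 Q w" using finite_graph_123 by blast
  define w' where "w' e = w (orb ` e)" for e
  have degree: "weighted_degree G w' u = weighted_degree Q w (orb u)" if u: "u \<in> verts G" for u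
  proof -
    have "neighbours Q (orb u) = orb ` neighbours G u"
      unfolding Q_def
    proof (rule neighbours_quotient[OF assms(1)])
      fix a b assume ab: "{a, b} \<in> edges G" "orb a = orb u"
      then have \<Gamma>: "u - a \<in> \<Gamma>" using \<Gamma>_closed(3)[of "a - u"] by (simp add: orb_eq)
      then have "{(u - a) + a, (u - a) + b} \<in> edges G"
        using ab(1) \<Gamma>_per mem_edges_translate[of "u - a" G a b] by blast
      then have "(u - a) + b \<in> neighbours G u" by (simp add: neighbours_def)
      then show "\<exists>v\<in>neighbours G u. orb v = orb b" using orb_shift[OF \<Gamma>] by blast
    qed
    moreover have "inj_on orb (neighbours G u)"
      using orb_inj[OF u] by (rule inj_on_subset) (auto simp: N_def)
    ultimately show ?thesis
      by (simp add: weighted_degree_def w'_def sum.reindex)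
  qed
  have "solution_123 G w'"
    unfolding solution_123_def
  proof (intro conjI allI impI Pi_I)
    show "w' e \<in> {1, 2, 3}" if "e \<in> edges G" for e
      using w that by (auto simp: solution_123_def w'_def Q_def)
    show "weighted_degree G w' u \<noteq> weighted_degree G w' v" if "{u, v} \<in> edges G" for u v
      using w orb_edge[OF that] edge_verts[OF that] by (simp add: solution_123_def degree)
  qed
  moreover have "w' (translate_edge t e) = w' e" if "t \<in> \<Gamma>" for t e
    using orb_shift[OF that] by (simp add: w'_def translate_edge_def image_image)
  ultimately show ?thesis
    using \<Gamma>_group \<Gamma>_per \<Gamma>_span unfolding fully_periodic_weights_def by blast
qed

end
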